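(* Let $n\ge 0$ be an integer, $c>0$ and $\lambda$ real numbers. Let $X$ be a metric space and $A\subset X$ a closed subset satisfying $\mathrm{Nagata}(n,c)$. Suppose $Y$ is a non-empty metric space that is Lipschitz $n$-connected with constant $\lambda$. Then every $1$-Lipschitz map $f\colon A\to Y$ admits a Lipschitz extension $F\colon X\to Y$ with Lipschitz constant at most $$10^{10^{10}}\cdot \lambda^{n+1}\cdot (c+1)^{10}\cdot (n+1)^{10\cdot n}.$$
   Context: A covering of a metric space (by arbitrary subsets) has $s$-multiplicity at most $m$ if every subset of the space of diameter less than $s$ meets at most $m$ members of the covering. A metric space $Z$ satisfies $\mathrm{Nagata}(n,c)$ if for every $s>0$ there is a covering of $Z$ which has $s$-multiplicity at most $n+1$ and each of whose members has diameter at most $c\cdot s$. The subset $A$ is considered with the induced metric. A metric space $Y$ is Lipschitz $n$-connected with constant $\lambda$ (satisfies $\mathrm{LC}(n,\lambda)$) if for every $0\le m\le n$ and every $L$, every $L$-Lipschitz map $f\colon S^m\to Y$ admits a $\lambda L$-Lipschitz extension $F\colon B^{m+1}\to Y$, where $B^{m+1}\subset\mathbb{R}^{m+1}$ is the Euclidean unit ball and $S^m=\partial B^{m+1}$, both with the metric induced by the Euclidean norm. *)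

theory Defs
  imports "HOL-Analysis.Analysis"
begin

text \<open>
  Metric spaces are subsets of types of class \<open>metric_space\<close>, with the induced metric.
  The library's \<open>diameter\<close> is only meaningful on bounded sets; an unbounded set has
  infinite diameter and hence never satisfies a diameter bound, so each such bound is
  accompanied by \<open>bounded\<close>.
\<close>

definition multiplicity_at_most ::
    "real \<Rightarrow> nat \<Rightarrow> 'a::metric_space set \<Rightarrow> 'a set set \<Rightarrow> bool" where
  "multiplicity_at_most s m Z \<B> \<longleftrightarrow>
     (\<forall>D\<subseteq>Z. bounded D \<and> diameter D < s \<longrightarrow>
        finite {B\<in>\<B>. B \<inter> D \<noteq> {}} \<and> card {B\<in>\<B>. B \<inter> D \<noteq> {}} \<le> m)"

definition nagata :: "nat \<Rightarrow> real \<Rightarrow> 'a::metric_space set \<Rightarrow> bool" where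
  "nagata n c Z \<longleftrightarrow>
     (\<forall>s>0. \<exists>\<B>. \<B> \<subseteq> Pow Z \<and> \<Union>\<B> = Z \<and>
        multiplicity_at_most s (n + 1) Z \<B> \<and>
        (\<forall>B\<in>\<B>. bounded B \<and> diameter B \<le> c * s))"

text \<open>
  The dimension is quantified inside the definition of Lipschitz connectedness, so
  \<open>\<real>\<^sup>d\<close> is represented by the functions \<open>nat \<Rightarrow> real\<close> vanishing outside \<open>{..<d}\<close>.
  The library's \<open>dist\<close> on \<open>nat \<Rightarrow> real\<close> is not the Euclidean one and is not used here.
\<close>

definition eucl_dist :: "nat \<Rightarrow> (nat \<Rightarrow> real) \<Rightarrow> (nat \<Rightarrow> real) \<Rightarrow> real" where
  "eucl_dist d x y = L2_set (\<lambda>i. x i - y i) {..<d}"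

definition eucl_ball :: "nat \<Rightarrow> (nat \<Rightarrow> real) set" where
  "eucl_ball d = {x. (\<forall>i\<ge>d. x i = 0) \<and> L2_set x {..<d} \<le> 1}"

text \<open>The unit sphere of \<open>\<real>\<^sup>d\<close>, that is, the sphere of dimension \<open>d - 1\<close>.\<close>

definition eucl_sphere :: "nat \<Rightarrow> (nat \<Rightarrow> real) set" where
  "eucl_sphere d = {x. (\<forall>i\<ge>d. x i = 0) \<and> L2_set x {..<d} = 1}"

text \<open>As in \<open>lipschitz_on\<close>, a Lipschitz constant is non-negative by definition.\<close>

definition eucl_lipschitz_on ::
    "nat \<Rightarrow> real \<Rightarrow> (nat \<Rightarrow> real) set \<Rightarrow> ((nat \<Rightarrow> real) \<Rightarrow> 'b::metric_space) \<Rightarrow> bool" where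
  "eucl_lipschitz_on d L U f \<longleftrightarrow>
     0 \<le> L \<and> (\<forall>x\<in>U. \<forall>y\<in>U. dist (f x) (f y) \<le> L * eucl_dist d x y)"

definition lipschitz_connected :: "nat \<Rightarrow> real \<Rightarrow> 'b::metric_space set \<Rightarrow> bool" where
  "lipschitz_connected n lam Y \<longleftrightarrow>
     (\<forall>m\<le>n. \<forall>L f. f \<in> eucl_sphere (m + 1) \<rightarrow> Y \<and>
          eucl_lipschitz_on (m + 1) L (eucl_sphere (m + 1)) f \<longrightarrow>
        (\<exists>F. F \<in> eucl_ball (m + 1) \<rightarrow> Y \<and>
          eucl_lipschitz_on (m + 1) (lam * L) (eucl_ball (m + 1)) F \<and>
          (\<forall>x\<in>eucl_sphere (m + 1). F x = f x)))"

end

theory Submission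
  imports Defs
begin

text \<open>
  At scale \<open>S j = (3 (c + 1))\<^sup>j\<close> a Nagata cover of \<open>A\<close> yields a partition of unity on the points of
  \<open>X\<close> at height (distance to \<open>A\<close>) at most \<open>S j\<close>, with at most \<open>n + 1\<close> non-zero entries. Sending
  each member of the cover to a member of the next scale that it meets is compatible with these
  supports, so moving through the triangulated mapping cylinder as the height grows gives a map
  from \<open>X - A\<close> to a complex of dimension only \<open>n + 1\<close>, locally Lipschitz with constant inversely
  proportional to the height. The vertices are sent to \<open>Y\<close> by \<open>f\<close>, and Lipschitz
  \<open>n\<close>-connectedness fills in the simplices one dimension at a time, each step costing a factor
  \<open>lam\<close> times a power of the dimension. Since each simplex is filled with respect to its standard
  metric, only the diameter of its vertex set depends on \<open>c\<close>, and this diameter is proportional to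
  the height.

  Points of the complex are finitely supported functions on the vertices, and distances between
  them are measured in the sup norm.
\<close>

section \<open>Simplices with the sup metric\<close>

text \<open>The obstacle is dimension. \<open>lipschitz_connected n lam Y\<close> fills spheres of
  dimension at most \<open>n\<close>, hence simplices with at most \<open>n + 2\<close> vertices,
  while a linear interpolation between the partitions of unity of two consecutive scales may involve
  \<open>2 * n + 2\<close> vertices. The vertex map removes this: the pushed partition of one scale
  and the partition of the next both live on the at most \<open>n + 1\<close> neighbours at the next
  scale, so they may be joined linearly, and the one move that leaves this simplex, the prism, adds
  a single vertex. The ratio \<open>3 * (c + 1)\<close> is large enough for the chosen point of a
  neighbouring member at one scale to stay within the neighbour radius of the next. Scales are
  indexed by integers because heights come arbitrarily close to 0 and may be arbitrarily large. All
  sums in the estimates run over boundedly many vertices, so working coordinatewise costs only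
  powers of \<open>n + 1\<close>. Two points that are far apart compared with their heights are
  compared through \<open>A\<close>, others inside the complex; the threshold depends on
  \<open>n\<close> alone, so that \<open>c\<close> enters the constant only through the diameters of
  the vertex sets.\<close>

definition std_simplex :: "'i set \<Rightarrow> ('i \<Rightarrow> real) set" where
  "std_simplex \<sigma> = {p. (\<forall>i. 0 \<le> p i) \<and> (\<forall>i. i \<notin> \<sigma> \<longrightarrow> p i = 0) \<and> sum p \<sigma> = 1}"

text \<open>Quantifying over all upper bounds \<open>\<delta>\<close> replaces the sup norm, so no
  supremum over a possibly infinite index type is formed.\<close>

definition sup_lipschitz_on ::
    "real \<Rightarrow> ('i \<Rightarrow> real) set \<Rightarrow> (('i \<Rightarrow> real) \<Rightarrow> 'b::metric_space) \<Rightarrow> bool" where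
  "sup_lipschitz_on L S G \<longleftrightarrow>
     (\<forall>p\<in>S. \<forall>q\<in>S. \<forall>\<delta>. (\<forall>i. \<bar>p i - q i\<bar> \<le> \<delta>) \<longrightarrow> dist (G p) (G q) \<le> L * \<delta>)"

lemma sup_lipschitz_onD:
  assumes "sup_lipschitz_on L S G" "p \<in> S" "q \<in> S" "\<And>i. \<bar>p i - q i\<bar> \<le> \<delta>"
  shows "dist (G p) (G q) \<le> L * \<delta>"
  using assms unfolding sup_lipschitz_on_def by blast

lemma sup_bound_nonneg:
  fixes p q :: "'i \<Rightarrow> real"
  assumes "\<And>i. \<bar>p i - q i\<bar> \<le> \<delta>"
  shows "0 \<le> \<delta>"
  using assms[of undefined] abs_ge_zero order_trans by blast

lemma sup_lipschitz_on_le: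
  assumes "sup_lipschitz_on L S G" "L \<le> M" "T \<subseteq> S"
  shows "sup_lipschitz_on M T G"
  unfolding sup_lipschitz_on_def
proof (intro ballI allI impI)
  fix p q \<delta> assume *: "p \<in> T" "q \<in> T" "\<forall>i. \<bar>p i - q i\<bar> \<le> \<delta>"
  then have "dist (G p) (G q) \<le> L * \<delta>"
    using assms(3) by (intro sup_lipschitz_onD[OF assms(1)]) auto
  also have "\<dots> \<le> M * \<delta>"
    using assms(2) sup_bound_nonneg[of p q \<delta>] * by (intro mult_right_mono) auto
  finally show "dist (G p) (G q) \<le> M * \<delta>" .
qed

lemma std_simplex_mono:
  assumes "finite \<sigma>" "\<tau> \<subseteq> \<sigma>"
  shows "std_simplex \<tau> \<subseteq> std_simplex \<sigma>"
proof
  fix p assume p: "p \<in> std_simplex \<tau>"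
  then have "sum p \<sigma> = sum p \<tau>"
    using assms by (intro sum.mono_neutral_right) (auto simp: std_simplex_def)
  with p assms show "p \<in> std_simplex \<sigma>"
    by (auto simp: std_simplex_def)
qed

lemma std_simplex_le_one:
  assumes "finite \<sigma>" "p \<in> std_simplex \<sigma>"
  shows "p i \<le> 1"
proof (cases "i \<in> \<sigma>")
  case True
  then have "p i \<le> sum p \<sigma>"
    using assms by (intro member_le_sum) (auto simp: std_simplex_def)
  then show ?thesis
    using assms by (simp add: std_simplex_def)
next
  case False
  then show ?thesis
    using assms by (simp add: std_simplex_def)
qed

lemma std_simplex_nonneg: "p \<in> std_simplex \<sigma> \<Longrightarrow> 0 \<le> p i"
  by (simp add: std_simplex_def)

lemma std_simplex_support:
  assumes "p \<in> std_simplex \<sigma>"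
  shows "{i. p i \<noteq> 0} \<subseteq> \<sigma>"
  using assms by (auto simp: std_simplex_def)

lemma std_simplex_shrink:
  assumes "finite \<sigma>" "p \<in> std_simplex \<sigma>" "\<tau> \<subseteq> \<sigma>" "\<And>i. i \<in> \<sigma> - \<tau> \<Longrightarrow> p i = 0"
  shows "p \<in> std_simplex \<tau>"
proof -
  have "sum p \<sigma> = sum p \<tau>"
    using assms by (intro sum.mono_neutral_right) auto
  then show ?thesis
    using assms by (fastforce simp: std_simplex_def)
qed

text \<open>Outside \<open>\<tau>\<close> the point \<open>q\<close> vanishes, so \<open>p\<close>
  has mass at most \<open>N * \<delta>\<close> there. Moving this mass to the common vertex
  \<open>k\<close> gives a point \<open>z\<close> of the common face, within
  \<open>N * \<delta>\<close> of \<open>p\<close> and \<open>2 * N * \<delta>\<close> of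
  \<open>q\<close>, and each of the two comparisons stays in one simplex.\<close>

lemma sup_lipschitz_glue:
  fixes p q :: "'i \<Rightarrow> real"
  assumes fin: "finite \<sigma>" "card \<sigma> \<le> N" and k: "k \<in> \<sigma>" "k \<in> \<tau>" "finite \<tau>" and L: "0 \<le> L"
    and G: "sup_lipschitz_on L (std_simplex \<sigma>) G" "sup_lipschitz_on L (std_simplex \<tau>) G"
    and p: "p \<in> std_simplex \<sigma>" and q: "q \<in> std_simplex \<tau>"
    and d: "\<And>i. \<bar>p i - q i\<bar> \<le> \<delta>"
  shows "dist (G p) (G q) \<le> L * (3 * real N * \<delta>)"
proof -
  have d0: "0 \<le> \<delta>" using sup_bound_nonneg[of p q] d by blast
  have N1: "1 \<le> real N" using fin k(1) by (metis One_nat_def Suc_leI card_gt_0_iff empty_iff of_nat_1 of_nat_le_iff order_trans)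
  define s where "s = sum p (\<sigma> - \<tau>)"
  define z where "z = (\<lambda>i. (if i \<in> \<tau> then p i else 0) + (if i = k then s else 0))"
  have p0: "\<And>i. 0 \<le> p i" "\<And>i. i \<notin> \<sigma> \<Longrightarrow> p i = 0" "sum p \<sigma> = 1"
    using p by (auto simp: std_simplex_def)
  have out: "p i \<le> \<delta>" if "i \<notin> \<tau>" for i
    using d[of i] q that by (auto simp: std_simplex_def)
  have s0: "0 \<le> s" unfolding s_def using p0 by (intro sum_nonneg) auto
  have "s \<le> (\<Sum>i\<in>\<sigma> - \<tau>. \<delta>)"
    unfolding s_def using out by (intro sum_mono) auto
  also have "\<dots> = real (card (\<sigma> - \<tau>)) * \<delta>" by simp
  also have "\<dots> \<le> real N * \<delta>"
    using fin d0 by (intro mult_right_mono) (auto intro: order_trans[OF card_mono])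
  finally have sN: "s \<le> real N * \<delta>" .
  have Nd: "\<delta> \<le> real N * \<delta>" using N1 d0 by (simp add: mult_le_cancel_right1)
  have zint: "z \<in> std_simplex (\<sigma> \<inter> \<tau>)"
  proof -
    have "sum z (\<sigma> \<inter> \<tau>) = sum p (\<sigma> \<inter> \<tau>) + s"
      using fin k unfolding z_def by (simp add: sum.distrib)
    also have "\<dots> = sum p \<sigma>"
      unfolding s_def using fin(1) by (metis sum.Int_Diff)
    finally show ?thesis
      using p0 s0 k unfolding std_simplex_def z_def by auto
  qed
  have pz: "\<bar>p i - z i\<bar> \<le> real N * \<delta>" for i
    using out[of i] p0(1)[of i] s0 sN Nd k unfolding z_def by auto
  have zq: "\<bar>z i - q i\<bar> \<le> 2 * real N * \<delta>" for i
  proof (cases "i = k")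
    case True
    then have "\<bar>z i - q i\<bar> \<le> \<bar>p i - q i\<bar> + s"
      using k s0 unfolding z_def by auto
    then show ?thesis using d[of i] sN Nd by linarith
  next
    case False
    have "\<bar>z i - q i\<bar> \<le> \<delta>"
      using False d[of i] d0 q by (auto simp: z_def std_simplex_def)
    then show ?thesis using Nd d0 by linarith
  qed
  have "dist (G p) (G z) \<le> L * (real N * \<delta>)"
    using zint std_simplex_mono[of \<sigma> "\<sigma> \<inter> \<tau>"] fin p pz by (intro sup_lipschitz_onD[OF G(1)]) auto
  moreover have "dist (G z) (G q) \<le> L * (2 * real N * \<delta>)"
    using zint std_simplex_mono[of \<tau> "\<sigma> \<inter> \<tau>"] k q zq by (intro sup_lipschitz_onD[OF G(2)]) auto
  ultimately show ?thesis
    using dist_triangle[of "G p" "G q" "G z"] by (simp add: algebra_simps)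
qed

section \<open>The simplex and the Euclidean ball\<close>

text \<open>
  A point of the \<open>d\<close>-simplex, translated by the barycentre, is described by its first \<open>d\<close>
  coordinates; \<open>full_coord\<close> restores the last one. The gauge of the translated simplex equals 1
  exactly on its boundary, so rescaling along rays from the barycentre matches simplex and ball.
\<close>

definition full_coord :: "nat \<Rightarrow> (nat \<Rightarrow> real) \<Rightarrow> nat \<Rightarrow> real" where
  "full_coord d x i = (if i < d then x i else - sum x {..<d})"

text \<open>The translated simplex is cut out by the inequalities
  \<open>full_coord d x i \<ge> - 1 / (d + 1)\<close> for \<open>i \<le> d\<close>; the formula is
  its Minkowski functional.\<close>

definition simplex_gauge :: "nat \<Rightarrow> (nat \<Rightarrow> real) \<Rightarrow> real" where
  "simplex_gauge d x = real (d + 1) * Max ((\<lambda>i. - full_coord d x i) ` {..d})"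

lemma sum_full_coord: "(\<Sum>i\<le>d. full_coord d x i) = 0"
proof -
  have "(\<Sum>i\<le>d. full_coord d x i) = (\<Sum>i<d. full_coord d x i) + full_coord d x d"
    by (simp add: lessThan_Suc_atMost[symmetric])
  then show ?thesis by (simp add: full_coord_def)
qed

lemma full_coord_ge_gauge:
  assumes "i \<le> d"
  shows "real (d + 1) * - full_coord d x i \<le> simplex_gauge d x"
  unfolding simplex_gauge_def using assms by (intro mult_left_mono Max_ge) auto

lemma simplex_gauge_attained:
  obtains i where "i \<le> d" "simplex_gauge d x = real (d + 1) * - full_coord d x i"
proof -
  have "Max ((\<lambda>i. - full_coord d x i) ` {..d}) \<in> (\<lambda>i. - full_coord d x i) ` {..d}"
    by (intro Max_in) auto
  then obtain i where "i \<le> d" "Max ((\<lambda>i. - full_coord d x i) ` {..d}) = - full_coord d x i"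
    unfolding image_iff by (metis atMost_iff)
  then show ?thesis using that[of i] unfolding simplex_gauge_def by simp
qed

lemma full_coord_diff:
  assumes "1 \<le> d"
  shows "\<bar>full_coord d x i - full_coord d y i\<bar> \<le> real d * eucl_dist d x y"
proof (cases "i < d")
  case True
  have "\<bar>x i - y i\<bar> \<le> eucl_dist d x y"
    unfolding eucl_dist_def using member_le_L2_set[of "{..<d}" i "\<lambda>i. \<bar>x i - y i\<bar>"] True
    by (simp add: L2_set_def)
  also have "\<dots> \<le> real d * eucl_dist d x y"
    using assms mult_right_mono[of 1 "real d" "eucl_dist d x y"]
    by (simp add: eucl_dist_def L2_set_nonneg)
  finally show ?thesis using True by (simp add: full_coord_def)
next
  case False
  have "\<bar>full_coord d x i - full_coord d y i\<bar> = \<bar>\<Sum>j<d. x j - y j\<bar>"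
    using False by (simp add: full_coord_def sum_subtractf)
  also have "\<dots> \<le> (\<Sum>j<d. \<bar>x j - y j\<bar>)" by (rule sum_abs)
  also have "\<dots> \<le> (\<Sum>j<d. eucl_dist d x y)"
  proof (intro sum_mono)
    fix j assume "j \<in> {..<d}"
    then show "\<bar>x j - y j\<bar> \<le> eucl_dist d x y"
      unfolding eucl_dist_def using member_le_L2_set[of "{..<d}" j "\<lambda>i. \<bar>x i - y i\<bar>"]
      by (simp add: L2_set_def)
  qed
  finally show ?thesis by simp
qed

lemma simplex_gauge_lipschitz:
  assumes "1 \<le> d"
  shows "\<bar>simplex_gauge d x - simplex_gauge d y\<bar> \<le> real (d + 1) * real d * eucl_dist d x y"
proof -
  have *: "simplex_gauge d x - simplex_gauge d y \<le> real (d + 1) * real d * eucl_dist d x y" for x y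
  proof -
    obtain i where i: "i \<le> d" "simplex_gauge d x = real (d + 1) * - full_coord d x i"
      by (rule simplex_gauge_attained)
    have "real (d + 1) * (- full_coord d x i) \<le> real (d + 1) * (- full_coord d y i + real d * eucl_dist d x y)"
      using full_coord_diff[OF assms, of x i y] by (intro mult_left_mono) auto
    then show ?thesis
      using full_coord_ge_gauge[OF i(1), of y] i(2) by (simp add: algebra_simps)
  qed
  have "eucl_dist d x y = eucl_dist d y x"
    by (simp add: eucl_dist_def L2_set_def power2_commute)
  with *[of x y] *[of y x] show ?thesis by (simp add: abs_le_iff)
qed

lemma full_coord_scale: "full_coord d (\<lambda>i. a * x i) i = a * full_coord d x i"
  by (simp add: full_coord_def sum_distrib_left)

lemma simplex_gauge_scale:
  assumes "0 \<le> a"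
  shows "simplex_gauge d (\<lambda>i. a * x i) = a * simplex_gauge d x"
proof (rule antisym)
  obtain i where i: "i \<le> d" "simplex_gauge d (\<lambda>i. a * x i) = real (d + 1) * - full_coord d (\<lambda>i. a * x i) i"
    by (rule simplex_gauge_attained)
  have "simplex_gauge d (\<lambda>i. a * x i) = a * (real (d + 1) * - full_coord d x i)"
    unfolding i(2) full_coord_scale by simp
  also have "\<dots> \<le> a * simplex_gauge d x"
    using assms full_coord_ge_gauge[OF i(1), of x] by (intro mult_left_mono) auto
  finally show "simplex_gauge d (\<lambda>i. a * x i) \<le> a * simplex_gauge d x" .
  obtain k where k: "k \<le> d" "simplex_gauge d x = real (d + 1) * - full_coord d x k"
    by (rule simplex_gauge_attained)
  have "a * simplex_gauge d x = real (d + 1) * - full_coord d (\<lambda>i. a * x i) k"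
    unfolding k(2) full_coord_scale by simp
  also have "\<dots> \<le> simplex_gauge d (\<lambda>i. a * x i)"
    by (rule full_coord_ge_gauge[OF k(1)])
  finally show "a * simplex_gauge d x \<le> simplex_gauge d (\<lambda>i. a * x i)" .
qed

text \<open>All coordinates are at least \<open>- M\<close>, so each satisfies
  \<open>\<bar>t\<bar> \<le> t + 2 * M\<close>; in the sum over the \<open>d + 1\<close> coordinates
  the linear terms cancel.\<close>

lemma norm_le_simplex_gauge: "L2_set x {..<d} \<le> 2 * simplex_gauge d x"
proof -
  define M where "M = simplex_gauge d x / real (d + 1)"
  have M: "- full_coord d x i \<le> M" if "i \<le> d" for i
    using full_coord_ge_gauge[OF that, of x] unfolding M_def by (simp add: field_simps)
  have M0: "0 \<le> M"
  proof (rule ccontr)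
    assume "\<not> 0 \<le> M"
    then have "0 < (\<Sum>i\<le>d. full_coord d x i)"
      using M by (intro sum_pos) (force+)
    then show False by (simp add: sum_full_coord)
  qed
  have "L2_set x {..<d} \<le> (\<Sum>i<d. \<bar>x i\<bar>)" by (rule L2_set_le_sum_abs)
  also have "\<dots> = (\<Sum>i<d. \<bar>full_coord d x i\<bar>)" by (simp add: full_coord_def)
  also have "\<dots> \<le> (\<Sum>i\<le>d. \<bar>full_coord d x i\<bar>)"
    by (intro sum_mono2) auto
  also have "\<dots> \<le> (\<Sum>i\<le>d. full_coord d x i + 2 * M)"
    using M M0 by (intro sum_mono) (force simp: abs_if)
  also have "\<dots> = 2 * simplex_gauge d x"
    by (simp add: sum.distrib sum_full_coord M_def)
  finally show ?thesis .
qed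

lemma eucl_dist_nonneg: "0 \<le> eucl_dist d x y"
  by (simp add: eucl_dist_def L2_set_nonneg)

lemma L2_set_scale: "L2_set (\<lambda>i. a * x i) S = \<bar>a\<bar> * L2_set x S"
proof -
  have "L2_set (\<lambda>i. a * x i) S = L2_set (\<lambda>i. \<bar>a\<bar> * x i) S"
    by (simp add: L2_set_def power_mult_distrib)
  then show ?thesis by (simp add: L2_set_right_distrib)
qed

lemma L2_set_scaled_diff:
  "L2_set (\<lambda>i. a * x i - b * y i) S \<le> \<bar>a\<bar> * L2_set (\<lambda>i. x i - y i) S + \<bar>a - b\<bar> * L2_set y S"
proof -
  have "L2_set (\<lambda>i. a * x i - b * y i) S = L2_set (\<lambda>i. a * (x i - y i) + (a - b) * y i) S"
    by (simp add: algebra_simps)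
  also have "\<dots> \<le> L2_set (\<lambda>i. a * (x i - y i)) S + L2_set (\<lambda>i. (a - b) * y i) S"
    by (rule L2_set_triangle_ineq)
  finally show ?thesis by (simp add: L2_set_scale)
qed

lemma L2_set_diff_le: "\<bar>L2_set x S - L2_set y S\<bar> \<le> L2_set (\<lambda>i. x i - y i) S"
proof -
  have *: "L2_set x S \<le> L2_set (\<lambda>i. x i - y i) S + L2_set y S" for x y
    using L2_set_triangle_ineq[of "\<lambda>i. x i - y i" y S] by simp
  have "L2_set (\<lambda>i. x i - y i) S = L2_set (\<lambda>i. y i - x i) S"
    by (simp add: L2_set_def power2_commute)
  with *[of x y] *[of y x] show ?thesis by (simp add: abs_le_iff)
qed

lemma simplex_gauge_nonneg: "0 \<le> simplex_gauge d x"
  using norm_le_simplex_gauge[of x d] L2_set_nonneg[of x "{..<d}"] by linarith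

lemma simplex_gauge_le_norm:
  assumes "1 \<le> d"
  shows "simplex_gauge d x \<le> real (d + 1) * real d * L2_set x {..<d}"
proof -
  have "simplex_gauge d (\<lambda>i. 0) = 0"
    using simplex_gauge_scale[of 0 d "\<lambda>i. 0"] by simp
  then show ?thesis
    using simplex_gauge_lipschitz[OF assms, of x "\<lambda>i. 0"] by (simp add: eucl_dist_def)
qed

text \<open>The radial map that turns the gauge into the Euclidean norm. Where the norm vanishes,
  division by zero returns the origin.\<close>

definition gauge_to_ball :: "nat \<Rightarrow> (nat \<Rightarrow> real) \<Rightarrow> nat \<Rightarrow> real" where
  "gauge_to_ball d x = (\<lambda>i. simplex_gauge d x / L2_set x {..<d} * x i)"

text \<open>The inverse radial map, restricted to the sphere: a filling needs an inverse only on the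
  boundary.\<close>

definition sphere_to_gauge :: "nat \<Rightarrow> (nat \<Rightarrow> real) \<Rightarrow> nat \<Rightarrow> real" where
  "sphere_to_gauge d u = (\<lambda>i. inverse (simplex_gauge d u) * u i)"

lemma norm_gauge_to_ball:
  assumes "1 \<le> d"
  shows "L2_set (gauge_to_ball d x) {..<d} = simplex_gauge d x"
proof (cases "L2_set x {..<d} = 0")
  case True
  then show ?thesis
    using simplex_gauge_le_norm[OF assms, of x] simplex_gauge_nonneg[of d x]
    by (simp add: gauge_to_ball_def L2_set_def)
next
  case False
  then show ?thesis
    using simplex_gauge_nonneg[of d x] L2_set_nonneg[of x "{..<d}"]
    unfolding gauge_to_ball_def L2_set_scale by simp
qed

text \<open>The scaling factor \<open>g / N\<close> is bounded by \<open>R\<close> but need not be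
  Lipschitz near the origin. Only its variation times \<open>N y\<close> is needed, and there the
  denominators cancel, leaving differences of \<open>N\<close> and of \<open>g\<close>. The bounded
  factor contributes \<open>R\<close>, the variation \<open>2 * R\<close>.\<close>

lemma gauge_to_ball_lipschitz:
  assumes d: "1 \<le> d"
  shows "eucl_dist d (gauge_to_ball d x) (gauge_to_ball d y)
           \<le> 3 * (real (d + 1) * real d) * eucl_dist d x y"
proof -
  define R where "R = real (d + 1) * real d"
  define N where "N = (\<lambda>x. L2_set x {..<d})"
  define g where "g = simplex_gauge d"
  have R0: "0 \<le> R" by (simp add: R_def)
  have N0: "0 \<le> N x" for x by (simp add: N_def L2_set_nonneg)
  have g0: "0 \<le> g x" "g x \<le> R * N x" for x
    using simplex_gauge_le_norm[OF d] simplex_gauge_nonneg by (auto simp: g_def N_def R_def)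
  have a: "\<bar>g x / N x\<bar> \<le> R"
    using g0[of x] N0[of x] R0 by (cases "N x = 0") (auto simp: field_simps)
  have gl: "\<bar>g x - g y\<bar> \<le> R * eucl_dist d x y"
    using simplex_gauge_lipschitz[OF d] by (simp add: g_def R_def)
  have Nl: "\<bar>N y - N x\<bar> \<le> eucl_dist d x y"
    using L2_set_diff_le[of x "{..<d}" y] by (simp add: N_def eucl_dist_def abs_minus_commute)
  have "\<bar>g x / N x - g y / N y\<bar> * N y \<le> 2 * R * eucl_dist d x y"
  proof (cases "N y = 0")
    case True
    then show ?thesis using R0 eucl_dist_nonneg[of d x y] by simp
  next
    case False
    have "\<bar>g x / N x - g y / N y\<bar> * N y = \<bar>(g x / N x - g y / N y) * N y\<bar>"
      using N0[of y] by (simp add: abs_mult)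
    also have "\<dots> = \<bar>g x / N x * (N y - N x) + (g x - g y)\<bar>"
    proof (cases "N x = 0")
      case True
      then show ?thesis using g0[of x] False by simp
    next
      case nx: False
      with False have "(g x / N x - g y / N y) * N y = g x / N x * (N y - N x) + (g x - g y)"
        by (simp add: field_simps)
      then show ?thesis by (rule arg_cong)
    qed
    also have "\<dots> \<le> \<bar>g x / N x\<bar> * \<bar>N y - N x\<bar> + \<bar>g x - g y\<bar>"
      unfolding abs_mult[symmetric] by (rule abs_triangle_ineq)
    also have "\<dots> \<le> R * eucl_dist d x y + R * eucl_dist d x y"
      using a Nl gl R0 by (intro add_mono mult_mono) auto
    finally show ?thesis by simp
  qed
  moreover have "\<bar>g x / N x\<bar> * eucl_dist d x y \<le> R * eucl_dist d x y"
    using a eucl_dist_nonneg by (rule mult_right_mono)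
  ultimately show ?thesis
    using L2_set_scaled_diff[of "g x / N x" x "g y / N y" y "{..<d}"]
    unfolding gauge_to_ball_def eucl_dist_def by (simp add: N_def g_def R_def)
qed

lemma sphere_to_gauge_lipschitz:
  assumes d: "1 \<le> d" and u: "L2_set u {..<d} = 1" and v: "L2_set v {..<d} = 1"
  shows "eucl_dist d (sphere_to_gauge d u) (sphere_to_gauge d v)
           \<le> (2 + 4 * (real (d + 1) * real d)) * eucl_dist d u v"
proof -
  define g where "g = simplex_gauge d"
  define e where "e = eucl_dist d u v"
  \<comment> \<open>The gauge is at least 1/2 on the unit sphere, so its inverse is at most 2; this
    gives the 2, and as \<open>2 * 2\<close> the 4, in the constant.\<close>
  have g: "1 / 2 \<le> g u" "1 / 2 \<le> g v"
    using norm_le_simplex_gauge[of u d] norm_le_simplex_gauge[of v d] u v by (auto simp: g_def)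
  have e0: "0 \<le> e" by (simp add: e_def eucl_dist_nonneg)
  have iu: "inverse (g u) \<le> 2" "inverse (g v) \<le> 2" "0 < g u" "0 < g v"
    using g le_imp_inverse_le[of "1/2"] by auto
  have "inverse (g u) - inverse (g v) = (g v - g u) * (inverse (g u) * inverse (g v))"
    using iu by (simp add: field_simps)
  then have "\<bar>inverse (g u) - inverse (g v)\<bar> = \<bar>g u - g v\<bar> * (inverse (g u) * inverse (g v))"
    using iu by (simp only: abs_mult abs_minus_commute) simp
  also have "\<dots> \<le> (real (d + 1) * real d * e) * (2 * 2)"
    using iu simplex_gauge_lipschitz[OF d, of u v] e0
    by (intro mult_mono) (auto simp: g_def e_def)
  finally have 1: "\<bar>inverse (g u) - inverse (g v)\<bar> \<le> real (d + 1) * real d * e * 4" by simp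
  have "\<bar>inverse (g u)\<bar> * e \<le> 2 * e"
    using iu e0 by (intro mult_right_mono) auto
  then show ?thesis
    using 1 L2_set_scaled_diff[of "inverse (g u)" u "inverse (g v)" v "{..<d}"] v
    unfolding sphere_to_gauge_def eucl_dist_def e_def g_def by (simp add: algebra_simps)
qed

definition simplex_boundary :: "'i set \<Rightarrow> ('i \<Rightarrow> real) set" where
  "simplex_boundary \<sigma> = {p \<in> std_simplex \<sigma>. \<exists>i\<in>\<sigma>. p i = 0}"

text \<open>The boundary of a simplex with \<open>m + 2\<close> vertices is an
  \<open>m\<close>-sphere. The map \<open>g\<close> is carried to the unit sphere, extended over the
  ball by Lipschitz connectedness, and pulled back along \<open>gauge_to_ball\<close>.\<close>

lemma cell_extension:
  fixes g :: "('i \<Rightarrow> real) \<Rightarrow> 'b::metric_space" and \<sigma> :: "'i set"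
  assumes LC: "lipschitz_connected n lam Y" and m: "m \<le> n" and lam: "0 \<le> lam"
    and \<sigma>: "finite \<sigma>" "card \<sigma> = m + 2" and L: "0 \<le> L"
    and gY: "g \<in> simplex_boundary \<sigma> \<rightarrow> Y" and gL: "sup_lipschitz_on L (simplex_boundary \<sigma>) g"
  obtains h where "h \<in> std_simplex \<sigma> \<rightarrow> Y" "\<And>p. p \<in> simplex_boundary \<sigma> \<Longrightarrow> h p = g p"
    "sup_lipschitz_on (lam * L * (18 * real (m + 2) ^ 6)) (std_simplex \<sigma>) h"
proof -
  define d where "d = m + 1"
  define b where "b = 1 / real (d + 1)"
  have d1: "1 \<le> d" and bd: "real (d + 1) * b = 1" by (auto simp: d_def b_def)
  define R where "R = real (d + 1) * real d"
  obtain e where e: "bij_betw e {..d} \<sigma>"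
  proof -
    have "card {..d} = card \<sigma>" using \<sigma> by (simp add: d_def)
    then show ?thesis using that \<sigma>(1) by (metis finite_atMost finite_same_card_bij)
  qed
  define e' where "e' = inv_into {..d} e"
  have e': "e' k \<le> d" "e (e' k) = k" if "k \<in> \<sigma>" for k
  proof -
    have "k \<in> e ` {..d}" using that e by (simp add: bij_betw_def)
    then show "e' k \<le> d" "e (e' k) = k"
      unfolding e'_def using inv_into_into[of k e "{..d}"] by (auto intro: f_inv_into_f)
  qed
  have ee: "e i \<in> \<sigma>" "e' (e i) = i" if "i \<le> d" for i
    using that e unfolding e'_def by (auto simp: bij_betw_def)
  \<comment> \<open>Here \<open>b\<close> is the value of the barycentre at each vertex.
    \<open>crd\<close> moves the barycentre to the origin and forgets the last coordinate;
    \<open>pt\<close> restores both.\<close>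
  define crd where "crd = (\<lambda>(p :: 'i \<Rightarrow> real) i. if i < d then p (e i) - b else 0)"
  define pt where "pt = (\<lambda>x k. if k \<in> \<sigma> then b + full_coord d x (e' k) else 0)"
  have sum_e: "sum p \<sigma> = (\<Sum>i\<le>d. p (e i))" for p :: "'i \<Rightarrow> real"
    using sum.reindex_bij_betw[OF e, of p] by simp
  have fc: "full_coord d (crd p) i = p (e i) - b" if p: "p \<in> std_simplex \<sigma>" and i: "i \<le> d" for p i
  proof (cases "i < d")
    case True
    then show ?thesis by (simp add: full_coord_def crd_def)
  next
    case False
    with i have [simp]: "i = d" by simp
    have "(\<Sum>i\<le>d. p (e i)) = 1"
      using p sum_e[of p] by (simp add: std_simplex_def)
    then have "(\<Sum>i<d. p (e i)) = 1 - p (e d)"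
      by (simp add: lessThan_Suc_atMost[symmetric])
    then show ?thesis
      using bd by (simp add: full_coord_def crd_def sum_subtractf algebra_simps)
  qed
  have pt_crd: "pt (crd p) = p" if "p \<in> std_simplex \<sigma>" for p
  proof
    fix k show "pt (crd p) k = p k"
      using that e'[of k] by (auto simp: pt_def fc std_simplex_def)
  qed
  have gauge_le: "simplex_gauge d (crd p) \<le> 1" if p: "p \<in> std_simplex \<sigma>" for p
  proof -
    obtain i where i: "i \<le> d" "simplex_gauge d (crd p) = real (d + 1) * - full_coord d (crd p) i"
      by (rule simplex_gauge_attained)
    have "- full_coord d (crd p) i \<le> b"
      using p by (simp add: fc[OF p i(1)] std_simplex_def)
    then have "real (d + 1) * - full_coord d (crd p) i \<le> real (d + 1) * b"
      by (intro mult_left_mono) auto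
    with i bd show ?thesis by simp
  qed
  have gauge_eq: "simplex_gauge d (crd p) = 1" if p: "p \<in> simplex_boundary \<sigma>" for p
  proof -
    have ps: "p \<in> std_simplex \<sigma>" using p by (simp add: simplex_boundary_def)
    from p obtain k where k: "k \<in> \<sigma>" "p k = 0" by (auto simp: simplex_boundary_def)
    have "full_coord d (crd p) (e' k) = - b"
      using fc[OF ps e'(1)[OF k(1)]] e'[OF k(1)] k(2) by simp
    then have "1 \<le> simplex_gauge d (crd p)"
      using full_coord_ge_gauge[OF e'(1)[OF k(1)], of "crd p"] bd by simp
    with gauge_le[OF ps] show ?thesis by simp
  qed
  have zero: "gauge_to_ball d (crd p) i = 0" if "i \<ge> d" for p i
    using that by (simp add: gauge_to_ball_def crd_def)
  have ball: "gauge_to_ball d (crd p) \<in> eucl_ball d" if "p \<in> std_simplex \<sigma>" for p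
    using norm_gauge_to_ball[OF d1] gauge_le[OF that] zero by (simp add: eucl_ball_def)
  have sphere: "gauge_to_ball d (crd p) \<in> eucl_sphere d" if "p \<in> simplex_boundary \<sigma>" for p
    using norm_gauge_to_ball[OF d1] gauge_eq[OF that] zero by (simp add: eucl_sphere_def)
  have inv_crd: "sphere_to_gauge d (gauge_to_ball d (crd p)) = crd p" if "p \<in> simplex_boundary \<sigma>" for p
  proof -
    have g1: "simplex_gauge d (crd p) = 1" by (rule gauge_eq[OF that])
    then have "L2_set (crd p) {..<d} \<noteq> 0"
      using simplex_gauge_le_norm[OF d1, of "crd p"] by auto
    then have N: "0 < L2_set (crd p) {..<d}" by (simp add: L2_set_nonneg less_le)
    have "simplex_gauge d (gauge_to_ball d (crd p)) = 1 / L2_set (crd p) {..<d}"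
      using N g1 simplex_gauge_scale[of "1 / L2_set (crd p) {..<d}" d "crd p"]
      unfolding gauge_to_ball_def by simp
    then show ?thesis
      using N g1 by (simp add: sphere_to_gauge_def gauge_to_ball_def)
  qed
  have pt_sphere: "pt (sphere_to_gauge d u) \<in> simplex_boundary \<sigma>" if u: "u \<in> eucl_sphere d" for u
  proof -
    have "1 \<le> 2 * simplex_gauge d u"
      using norm_le_simplex_gauge[of u d] u by (simp add: eucl_sphere_def)
    then have gu: "0 < simplex_gauge d u" by linarith
    have fcu: "full_coord d (sphere_to_gauge d u) i = full_coord d u i / simplex_gauge d u" for i
      by (simp only: sphere_to_gauge_def full_coord_scale) (simp add: divide_inverse mult.commute)
    have ge: "0 \<le> b + full_coord d (sphere_to_gauge d u) i" if "i \<le> d" for i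
      using full_coord_ge_gauge[OF that, of u] gu unfolding fcu b_def by (simp add: field_simps)
    obtain i where i: "i \<le> d" "simplex_gauge d u = real (d + 1) * - full_coord d u i"
      by (rule simplex_gauge_attained)
    have "b + full_coord d (sphere_to_gauge d u) i = 0"
    proof -
      have "full_coord d u i = - (b * simplex_gauge d u)"
        using i(2) bd by (simp add: b_def field_simps)
      then show ?thesis using gu unfolding fcu by simp
    qed
    then have "pt (sphere_to_gauge d u) (e i) = 0"
      using ee[OF i(1)] by (simp add: pt_def)
    moreover have "sum (pt (sphere_to_gauge d u)) \<sigma> = (\<Sum>i\<le>d. b + full_coord d (sphere_to_gauge d u) i)"
      unfolding sum_e using ee by (intro sum.cong) (auto simp: pt_def)
    moreover have "\<dots> = 1"
      using bd by (simp add: sum.distrib sum_full_coord algebra_simps)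
    moreover have "0 \<le> pt (sphere_to_gauge d u) k" for k
      using ge e' by (auto simp: pt_def)
    moreover have "pt (sphere_to_gauge d u) k = 0" if "k \<notin> \<sigma>" for k
      using that by (simp add: pt_def)
    ultimately have "pt (sphere_to_gauge d u) \<in> std_simplex \<sigma>"
      unfolding std_simplex_def by (intro CollectI conjI allI impI) simp_all
    with \<open>pt (sphere_to_gauge d u) (e i) = 0\<close> ee[OF i(1)] show ?thesis
      unfolding simplex_boundary_def by blast
  qed
  define L' where "L' = L * (real d * (2 + 4 * R))"
  have R0: "0 \<le> R" by (simp add: R_def)
  have lip: "eucl_lipschitz_on d L' (eucl_sphere d) (\<lambda>u. g (pt (sphere_to_gauge d u)))"
    unfolding eucl_lipschitz_on_def
  proof (intro conjI ballI)
    show "0 \<le> L'" using L R0 by (simp add: L'_def)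
    fix u v assume uv: "u \<in> eucl_sphere d" "v \<in> eucl_sphere d"
    have N: "L2_set u {..<d} = 1" "L2_set v {..<d} = 1"
      using uv by (auto simp: eucl_sphere_def)
    have "\<bar>pt (sphere_to_gauge d u) k - pt (sphere_to_gauge d v) k\<bar>
        \<le> real d * ((2 + 4 * R) * eucl_dist d u v)" for k
    proof -
      have "\<bar>pt (sphere_to_gauge d u) k - pt (sphere_to_gauge d v) k\<bar>
          \<le> real d * eucl_dist d (sphere_to_gauge d u) (sphere_to_gauge d v)"
        using full_coord_diff[OF d1, of "sphere_to_gauge d u" "e' k" "sphere_to_gauge d v"]
        by (auto simp: pt_def eucl_dist_nonneg)
      also have "\<dots> \<le> real d * ((2 + 4 * R) * eucl_dist d u v)"
        using sphere_to_gauge_lipschitz[OF d1 N] by (intro mult_left_mono) (auto simp: R_def)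
      finally show ?thesis .
    qed
    then have "dist (g (pt (sphere_to_gauge d u))) (g (pt (sphere_to_gauge d v)))
        \<le> L * (real d * ((2 + 4 * R) * eucl_dist d u v))"
      using uv pt_sphere by (intro sup_lipschitz_onD[OF gL]) auto
    then show "dist (g (pt (sphere_to_gauge d u))) (g (pt (sphere_to_gauge d v))) \<le> L' * eucl_dist d u v"
      by (simp add: L'_def mult_ac)
  qed
  have maps: "(\<lambda>u. g (pt (sphere_to_gauge d u))) \<in> eucl_sphere d \<rightarrow> Y"
    using pt_sphere gY by auto
  obtain F where F: "F \<in> eucl_ball d \<rightarrow> Y" "eucl_lipschitz_on d (lam * L') (eucl_ball d) F"
      "\<And>u. u \<in> eucl_sphere d \<Longrightarrow> F u = g (pt (sphere_to_gauge d u))"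
    using LC[unfolded lipschitz_connected_def, rule_format, OF m, folded d_def, OF conjI[OF maps lip]]
    by auto
  define h where "h = (\<lambda>p. F (gauge_to_ball d (crd p)))"
  show ?thesis
  proof (rule that)
    show "h \<in> std_simplex \<sigma> \<rightarrow> Y" using F(1) ball by (auto simp: h_def)
    show "h p = g p" if "p \<in> simplex_boundary \<sigma>" for p
      using F(3)[OF sphere[OF that]] inv_crd[OF that] pt_crd[of p] that
      by (simp add: h_def simplex_boundary_def)
    show "sup_lipschitz_on (lam * L * (18 * real (m + 2) ^ 6)) (std_simplex \<sigma>) h"
      unfolding sup_lipschitz_on_def
    proof (intro ballI allI impI)
      fix p q \<delta> assume p: "p \<in> std_simplex \<sigma>" and q: "q \<in> std_simplex \<sigma>"
        and \<delta>: "\<forall>i. \<bar>p i - q i\<bar> \<le> \<delta>"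
      have \<delta>0: "0 \<le> \<delta>" using sup_bound_nonneg[of p q] \<delta> by blast
      have "eucl_dist d (crd p) (crd q) \<le> (\<Sum>i<d. \<bar>crd p i - crd q i\<bar>)"
        unfolding eucl_dist_def by (rule L2_set_le_sum_abs)
      also have "\<dots> \<le> (\<Sum>i<d. \<delta>)"
        using \<delta> by (intro sum_mono) (auto simp: crd_def)
      finally have 1: "eucl_dist d (crd p) (crd q) \<le> real d * \<delta>" by simp
      have "dist (h p) (h q) \<le> lam * L' * eucl_dist d (gauge_to_ball d (crd p)) (gauge_to_ball d (crd q))"
        using F(2) ball p q unfolding h_def eucl_lipschitz_on_def by blast
      also have "\<dots> \<le> lam * L' * (3 * R * (real d * \<delta>))"
      proof (intro mult_left_mono)
        have "3 * R * eucl_dist d (crd p) (crd q) \<le> 3 * R * (real d * \<delta>)"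
          using 1 R0 by (intro mult_left_mono) auto
        then show "eucl_dist d (gauge_to_ball d (crd p)) (gauge_to_ball d (crd q)) \<le> 3 * R * (real d * \<delta>)"
          using gauge_to_ball_lipschitz[OF d1, of "crd p" "crd q"] unfolding R_def by linarith
        show "0 \<le> lam * L'" using lam L R0 by (simp add: L'_def)
      qed
      \<comment> \<open>The factor \<open>real d * (2 + 4 * R)\<close> comes from the map of the
        sphere to the boundary, \<open>3 * R * real d\<close> from the map of the simplex to the
        ball. As \<open>R\<close> is quadratic in the dimension, the product has degree 6.\<close>
      also have "\<dots> = lam * L * (real d * (2 + 4 * R) * (3 * R) * real d) * \<delta>"
        by (simp add: L'_def mult_ac)
      also have "\<dots> \<le> lam * L * (18 * real (m + 2) ^ 6) * \<delta>"
      proof (intro mult_right_mono mult_left_mono \<delta>0)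
        define D where "D = real (m + 2)"
        have dD: "real d \<le> D" "1 \<le> D" by (auto simp: d_def D_def)
        then have RD: "R \<le> D ^ 2"
          unfolding R_def power2_eq_square by (intro mult_mono) (auto simp: d_def D_def)
        have "1 \<le> D ^ 2" using dD by simp
        with RD have "2 + 4 * R \<le> 6 * D ^ 2" by linarith
        then have "real d * (2 + 4 * R) * (3 * R) * real d \<le> D * (6 * D ^ 2) * (3 * D ^ 2) * D"
          using dD RD R0 by (intro mult_mono) auto
        also have "\<dots> = 18 * D ^ 6" by (simp add: eval_nat_numeral)
        finally show "real d * (2 + 4 * R) * (3 * R) * real d \<le> 18 * real (m + 2) ^ 6"
          by (simp only: D_def)
        show "0 \<le> lam * L" using lam L by simp
      qed
      finally show "dist (h p) (h q) \<le> lam * L * (18 * real (m + 2) ^ 6) * \<delta>" .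
    qed
  qed
qed

section \<open>Filling in skeleta\<close>

lemma std_simplex_singleton: "std_simplex {i} = {\<lambda>j. if j = i then 1 else 0}"
  by (auto simp: std_simplex_def fun_eq_iff)

lemma dist_le_diameter_finite_image:
  assumes "finite \<sigma>" "i \<in> \<sigma>" "j \<in> \<sigma>"
  shows "dist (y i) (y j) \<le> diameter (y ` \<sigma>)"
  using assms by (intro diameter_bounded_bound finite_imp_bounded) auto

lemma boundary_lipschitz:
  fixes y :: "'i \<Rightarrow> 'b::metric_space"
  assumes \<sigma>: "finite \<sigma>" "card \<sigma> = k + 2" and K: "1 \<le> K"
    and vert: "\<And>i. G (\<lambda>j. if j = i then 1 else 0) = y i"
    and G: "\<And>\<tau>. \<lbrakk>finite \<tau>; \<tau> \<noteq> {}; card \<tau> \<le> k + 1\<rbrakk> \<Longrightarrow>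
              sup_lipschitz_on (K * diameter (y ` \<tau>)) (std_simplex \<tau>) G"
  shows "sup_lipschitz_on (K * diameter (y ` \<sigma>) * (3 * real (k + 2))) (simplex_boundary \<sigma>) G"
  unfolding sup_lipschitz_on_def
proof (intro ballI allI impI)
  fix p q \<delta> assume p: "p \<in> simplex_boundary \<sigma>" and q: "q \<in> simplex_boundary \<sigma>"
    and \<delta>: "\<forall>i. \<bar>p i - q i\<bar> \<le> \<delta>"
  define D where "D = diameter (y ` \<sigma>)"
  have D0: "0 \<le> D" unfolding D_def using \<sigma> by (intro diameter_ge_0 finite_imp_bounded) auto
  have \<delta>0: "0 \<le> \<delta>" using sup_bound_nonneg[of p q] \<delta> by blast
  obtain i where i: "i \<in> \<sigma>" "p i = 0" "p \<in> std_simplex \<sigma>"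
    using p by (auto simp: simplex_boundary_def)
  obtain j where j: "j \<in> \<sigma>" "q j = 0" "q \<in> std_simplex \<sigma>"
    using q by (auto simp: simplex_boundary_def)
  have pi: "p \<in> std_simplex (\<sigma> - {i})" and qj: "q \<in> std_simplex (\<sigma> - {j})"
    using i j \<sigma> by (auto intro!: std_simplex_shrink[of \<sigma>])
  have face: "sup_lipschitz_on (K * D) (std_simplex (\<sigma> - {l})) G" if "l \<in> \<sigma>" for l
  proof (rule sup_lipschitz_on_le)
    have c: "card (\<sigma> - {l}) = k + 1" using \<sigma> that by simp
    then have ne: "\<sigma> - {l} \<noteq> {}" by (metis add_is_0 card.empty one_neq_zero)
    show "sup_lipschitz_on (K * diameter (y ` (\<sigma> - {l}))) (std_simplex (\<sigma> - {l})) G"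
      by (rule G[OF _ ne]) (use \<sigma> c in simp_all)
    have "diameter (y ` (\<sigma> - {l})) \<le> D"
      unfolding D_def using \<sigma> by (intro diameter_subset finite_imp_bounded) auto
    then show "K * diameter (y ` (\<sigma> - {l})) \<le> K * D"
      using K by (intro mult_left_mono) auto
  qed auto
  have "dist (G p) (G q) \<le> K * D * (3 * real (k + 2) * \<delta>)"
  proof (cases "\<exists>l. l \<in> \<sigma> - {i} \<and> l \<in> \<sigma> - {j}")
    case True
    then obtain l where l: "l \<in> \<sigma> - {i}" "l \<in> \<sigma> - {j}" by blast
    show ?thesis
    proof (rule sup_lipschitz_glue[OF _ _ l])
      show "card (\<sigma> - {i}) \<le> k + 2" using \<sigma> i by simp
    qed (use \<sigma> K D0 face i j pi qj \<delta> in auto)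
  next
    case False
    then have s: "\<sigma> \<subseteq> {i, j}" by auto
    then have "card \<sigma> \<le> card {i, j}" by (intro card_mono) auto
    with \<sigma> have ij: "i \<noteq> j" and "k = 0" by (auto simp: card_insert_if split: if_splits)
    have si: "\<sigma> - {i} = {j}" "\<sigma> - {j} = {i}" using s ij i j by auto
    have pq: "p = (\<lambda>l. if l = j then 1 else 0)" "q = (\<lambda>l. if l = i then 1 else 0)"
      using pi qj unfolding si std_simplex_singleton by auto
    have d1: "1 \<le> \<delta>" using \<delta>[rule_format, of j] ij by (simp add: pq)
    have "dist (G p) (G q) = dist (y j) (y i)" unfolding pq vert ..
    also have "\<dots> \<le> D"
      unfolding D_def using \<sigma> i j by (intro dist_le_diameter_finite_image) auto
    also have "\<dots> = 1 * D * (1 * 1)" by simp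
    also have "\<dots> \<le> K * D * (3 * real (k + 2) * \<delta>)"
      using K D0 d1 by (intro mult_mono mult_nonneg_nonneg) auto
    finally show ?thesis .
  qed
  then show "dist (G p) (G q) \<le> K * diameter (y ` \<sigma>) * (3 * real (k + 2)) * \<delta>"
    by (simp add: D_def mult_ac)
qed

text \<open>Induction on the dimension. Each step multiplies the constant by
  \<open>3 * (k + 2)\<close> for passing from facets to the whole boundary and by
  \<open>18 * lam * (k + 2) ^ 6\<close> for filling the cell, hence the factor 54 and the power
  7.\<close>

lemma skeleton_extension:
  fixes y :: "'i \<Rightarrow> 'b::metric_space"
  assumes LC: "lipschitz_connected n lam Y" and lam: "1 \<le> lam" and y: "\<And>i. y i \<in> Y"
    and k: "k \<le> n + 1"
  shows "\<exists>G. (\<forall>i. G (\<lambda>j. if j = i then 1 else 0) = y i) \<and>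
    (\<forall>\<sigma>. finite \<sigma> \<and> \<sigma> \<noteq> {} \<and> card \<sigma> \<le> k + 1 \<longrightarrow>
      G \<in> std_simplex \<sigma> \<rightarrow> Y \<and>
      sup_lipschitz_on ((54 * lam * real (n + 2) ^ 7) ^ k * diameter (y ` \<sigma>)) (std_simplex \<sigma>) G)"
  using k
proof (induction k)
  case 0
  \<comment> \<open>Only the values at vertices matter, and there the choice is unique.\<close>
  define G where "G = (\<lambda>p :: 'i \<Rightarrow> real. y (SOME i. p i \<noteq> 0))"
  have vert: "G (\<lambda>j. if j = i then 1 else 0) = y i" for i
    unfolding G_def by (rule arg_cong[of _ _ y]) (rule some_equality, auto split: if_splits)
  show ?case
  proof (intro exI[of _ G] conjI allI impI vert)
    fix \<sigma> :: "'i set" assume "finite \<sigma> \<and> \<sigma> \<noteq> {} \<and> card \<sigma> \<le> 0 + 1"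
    then have "card \<sigma> = 1" by (metis One_nat_def Suc_leI add_0 card_gt_0_iff le_antisym)
    then obtain i where i: "\<sigma> = {i}" by (auto simp: card_1_singleton_iff)
    show "G \<in> std_simplex \<sigma> \<rightarrow> Y"
      using y by (auto simp: i std_simplex_singleton vert)
    show "sup_lipschitz_on ((54 * lam * real (n + 2) ^ 7) ^ 0 * diameter (y ` \<sigma>)) (std_simplex \<sigma>) G"
      by (simp add: i std_simplex_singleton sup_lipschitz_on_def)
  qed
next
  case (Suc k)
  define K where "K = 54 * lam * real (n + 2) ^ 7"
  have "1 * 1 * 1 \<le> K"
    unfolding K_def using lam by (intro mult_mono one_le_power) auto
  then have K1: "1 \<le> K" by simp
  from Suc obtain G where vert: "\<And>i. G (\<lambda>j. if j = i then 1 else 0) = y i"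
    and GY: "\<And>\<sigma>. \<lbrakk>finite \<sigma>; \<sigma> \<noteq> {}; card \<sigma> \<le> k + 1\<rbrakk> \<Longrightarrow> G \<in> std_simplex \<sigma> \<rightarrow> Y"
    and GL: "\<And>\<sigma>. \<lbrakk>finite \<sigma>; \<sigma> \<noteq> {}; card \<sigma> \<le> k + 1\<rbrakk> \<Longrightarrow>
               sup_lipschitz_on (K ^ k * diameter (y ` \<sigma>)) (std_simplex \<sigma>) G"
    unfolding K_def by auto
  have "\<exists>h. h \<in> std_simplex \<sigma> \<rightarrow> Y \<and> (\<forall>p\<in>simplex_boundary \<sigma>. h p = G p) \<and>
          sup_lipschitz_on (K ^ Suc k * diameter (y ` \<sigma>)) (std_simplex \<sigma>) h"
    if \<sigma>: "finite \<sigma>" "card \<sigma> = k + 2" for \<sigma>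
  proof -
    define D where "D = diameter (y ` \<sigma>)"
    have D0: "0 \<le> D" unfolding D_def using \<sigma> by (intro diameter_ge_0 finite_imp_bounded) auto
    have bY: "G \<in> simplex_boundary \<sigma> \<rightarrow> Y"
    proof
      fix p assume "p \<in> simplex_boundary \<sigma>"
      then obtain i where i: "i \<in> \<sigma>" "p i = 0" "p \<in> std_simplex \<sigma>"
        by (auto simp: simplex_boundary_def)
      have "p \<in> std_simplex (\<sigma> - {i})"
        using i \<sigma> by (auto intro!: std_simplex_shrink[of \<sigma>])
      moreover have "card (\<sigma> - {i}) = k + 1" using \<sigma> i by simp
      ultimately show "G p \<in> Y"
        using GY[of "\<sigma> - {i}"] \<sigma> by fastforce
    qed
    have "sup_lipschitz_on (K ^ k * D * (3 * real (k + 2))) (simplex_boundary \<sigma>) G"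
      unfolding D_def using \<sigma> K1 vert GL by (intro boundary_lipschitz) auto
    moreover have "0 \<le> K ^ k * D * (3 * real (k + 2))" using K1 D0 by simp
    moreover have "k \<le> n" using Suc.prems by simp
    ultimately obtain h where h: "h \<in> std_simplex \<sigma> \<rightarrow> Y" "\<And>p. p \<in> simplex_boundary \<sigma> \<Longrightarrow> h p = G p"
      "sup_lipschitz_on (lam * (K ^ k * D * (3 * real (k + 2))) * (18 * real (k + 2) ^ 6)) (std_simplex \<sigma>) h"
      using cell_extension[OF LC \<open>k \<le> n\<close> order_trans[OF zero_le_one lam] \<sigma> _ bY] by blast
    have "lam * (K ^ k * D * (3 * real (k + 2))) * (18 * real (k + 2) ^ 6)
        = 54 * lam * real (k + 2) ^ 7 * (K ^ k * D)"
      by (simp add: eval_nat_numeral algebra_simps)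
    also have "\<dots> \<le> K * (K ^ k * D)"
      unfolding K_def using lam Suc.prems K1 D0
      by (intro mult_right_mono mult_left_mono power_mono) (auto simp: K_def)
    finally have "sup_lipschitz_on (K ^ Suc k * D) (std_simplex \<sigma>) h"
      using sup_lipschitz_on_le[OF h(3)] by (simp add: mult.assoc)
    with h show ?thesis unfolding D_def by blast
  qed
  then have "\<forall>\<sigma>. \<exists>h. finite \<sigma> \<and> card \<sigma> = k + 2 \<longrightarrow> h \<in> std_simplex \<sigma> \<rightarrow> Y \<and>
      (\<forall>p\<in>simplex_boundary \<sigma>. h p = G p) \<and>
      sup_lipschitz_on (K ^ Suc k * diameter (y ` \<sigma>)) (std_simplex \<sigma>) h"
    by blast
  then obtain h where "\<forall>\<sigma>. finite \<sigma> \<and> card \<sigma> = k + 2 \<longrightarrow> h \<sigma> \<in> std_simplex \<sigma> \<rightarrow> Y \<and>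
      (\<forall>p\<in>simplex_boundary \<sigma>. h \<sigma> p = G p) \<and>
      sup_lipschitz_on (K ^ Suc k * diameter (y ` \<sigma>)) (std_simplex \<sigma>) (h \<sigma>)"
    unfolding choice_iff by blast
  then have h:
    "\<And>\<sigma>. \<lbrakk>finite \<sigma>; card \<sigma> = k + 2\<rbrakk> \<Longrightarrow> h \<sigma> \<in> std_simplex \<sigma> \<rightarrow> Y"
    "\<And>\<sigma> p. \<lbrakk>finite \<sigma>; card \<sigma> = k + 2; p \<in> simplex_boundary \<sigma>\<rbrakk> \<Longrightarrow> h \<sigma> p = G p"
    "\<And>\<sigma>. \<lbrakk>finite \<sigma>; card \<sigma> = k + 2\<rbrakk> \<Longrightarrow>
       sup_lipschitz_on (K ^ Suc k * diameter (y ` \<sigma>)) (std_simplex \<sigma>) (h \<sigma>)"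
    by blast+
  \<comment> \<open>Fillings are selected by exact support. A point of a simplex with
    \<open>k + 2\<close> vertices either has full support or lies on the boundary, where the filling
    equals \<open>G\<close>; so the separate choices fit together.\<close>
  define G' where "G' = (\<lambda>p. if card {i. p i \<noteq> 0} = k + 2 then h {i. p i \<noteq> 0} p else G p)"
  have G'_small: "G' p = G p" if "p \<in> std_simplex \<sigma>" "finite \<sigma>" "card \<sigma> \<le> k + 1" for p \<sigma>
  proof -
    have "card {i. p i \<noteq> 0} \<le> card \<sigma>"
      using that std_simplex_support by (intro card_mono) auto
    then show ?thesis using that by (simp add: G'_def)
  qed
  have G'_big: "G' p = h \<sigma> p" if p: "p \<in> std_simplex \<sigma>" and \<sigma>: "finite \<sigma>" "card \<sigma> = k + 2" for p \<sigma>
  proof (cases "{i. p i \<noteq> 0} = \<sigma>")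
    case True
    then show ?thesis using \<sigma> by (simp add: G'_def)
  next
    case False
    then have "{i. p i \<noteq> 0} \<subset> \<sigma>" using std_simplex_support[OF p] by auto
    then have c: "card {i. p i \<noteq> 0} < k + 2" using psubset_card_mono \<sigma> by metis
    have "p \<in> simplex_boundary \<sigma>"
      using False std_simplex_support[OF p] p by (auto simp: simplex_boundary_def)
    then show ?thesis using c h(2)[OF \<sigma>] by (simp add: G'_def)
  qed
  have "G' (\<lambda>j. if j = i then 1 else 0) = y i" for i
    using G'_small[of "\<lambda>j. if j = i then 1 else 0" "{i}"] vert by (simp add: std_simplex_singleton)
  moreover have "G' \<in> std_simplex \<sigma> \<rightarrow> Y \<and>
      sup_lipschitz_on (K ^ Suc k * diameter (y ` \<sigma>)) (std_simplex \<sigma>) G'"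
    if \<sigma>: "finite \<sigma>" "\<sigma> \<noteq> {}" "card \<sigma> \<le> Suc k + 1" for \<sigma>
  proof (cases "card \<sigma> = k + 2")
    case True
    have "sup_lipschitz_on (K ^ Suc k * diameter (y ` \<sigma>)) (std_simplex \<sigma>) G'"
      using h(3)[OF \<sigma>(1) True] G'_big[OF _ \<sigma>(1) True] unfolding sup_lipschitz_on_def by simp
    then show ?thesis using h(1)[OF \<sigma>(1) True] G'_big[OF _ \<sigma>(1) True] by auto
  next
    case False
    with \<sigma> have c: "card \<sigma> \<le> k + 1" by simp
    have D0: "0 \<le> diameter (y ` \<sigma>)" using \<sigma> by (intro diameter_ge_0 finite_imp_bounded) auto
    have "K ^ k \<le> K ^ Suc k" using K1 by (intro power_increasing) auto
    then have "sup_lipschitz_on (K ^ Suc k * diameter (y ` \<sigma>)) (std_simplex \<sigma>) G"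
      using sup_lipschitz_on_le[OF GL[OF \<sigma>(1,2) c] mult_right_mono] D0 by blast
    then have "sup_lipschitz_on (K ^ Suc k * diameter (y ` \<sigma>)) (std_simplex \<sigma>) G'"
      using G'_small[OF _ \<sigma>(1) c] unfolding sup_lipschitz_on_def by simp
    then show ?thesis using GY[OF \<sigma>(1,2) c] G'_small[OF _ \<sigma>(1) c] by auto
  qed
  ultimately show ?case unfolding K_def by blast
qed

section \<open>Pushing mass along a vertex map\<close>

text \<open>The restriction to the support makes sense of the mass of infinite sets
  \<open>J\<close>, such as fibres of a vertex map or predecessor sets.\<close>

definition mass :: "('i \<Rightarrow> real) \<Rightarrow> 'i set \<Rightarrow> real" where
  "mass p J = sum p {i \<in> J. p i \<noteq> 0}"

definition pushforward :: "('i \<Rightarrow> 'i) \<Rightarrow> ('i \<Rightarrow> real) \<Rightarrow> 'i \<Rightarrow> real" where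
  "pushforward \<rho> p k = mass p {i. \<rho> i = k}"

lemma mass_eq:
  assumes "finite S" "{i. p i \<noteq> 0} \<subseteq> S"
  shows "mass p J = sum p (S \<inter> J)"
  unfolding mass_def using assms by (intro sum.mono_neutral_left) auto

lemma mass_diff:
  assumes S: "finite S" "card S \<le> N" "{i. p i \<noteq> 0} \<subseteq> S"
    and T: "finite T" "card T \<le> N" "{i. q i \<noteq> 0} \<subseteq> T"
    and d: "\<And>i. \<bar>p i - q i\<bar> \<le> \<delta>"
  shows "\<bar>mass p J - mass q J\<bar> \<le> 2 * real N * \<delta>"
proof -
  have d0: "0 \<le> \<delta>" using sup_bound_nonneg[of p q] d by blast
  have "mass p J - mass q J = (\<Sum>i\<in>(S \<union> T) \<inter> J. p i - q i)"
    using S T mass_eq[of "S \<union> T" p J] mass_eq[of "S \<union> T" q J] by (simp add: sum_subtractf le_supI1 le_supI2)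
  also have "\<bar>\<dots>\<bar> \<le> (\<Sum>i\<in>(S \<union> T) \<inter> J. \<bar>p i - q i\<bar>)" by (rule sum_abs)
  also have "\<dots> \<le> (\<Sum>i\<in>(S \<union> T) \<inter> J. \<delta>)" using d by (intro sum_mono)
  also have "\<dots> = real (card ((S \<union> T) \<inter> J)) * \<delta>" by simp
  also have "\<dots> \<le> real (2 * N) * \<delta>"
  proof (intro mult_right_mono d0)
    have "card ((S \<union> T) \<inter> J) \<le> card (S \<union> T)" using S T by (intro card_mono) auto
    also have "\<dots> \<le> card S + card T" by (rule card_Un_le)
    finally show "real (card ((S \<union> T) \<inter> J)) \<le> real (2 * N)" using S T by simp
  qed
  finally show ?thesis by simp
qed

lemma mass_mono:
  assumes "p \<in> std_simplex \<sigma>" "finite \<sigma>" "J \<subseteq> J'"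
  shows "mass p J \<le> mass p J'"
  unfolding mass_def using assms std_simplex_support[OF assms(1)]
  by (intro sum_mono2) (auto simp: std_simplex_def intro: finite_subset[of _ \<sigma>])

lemma mass_nonneg:
  assumes "\<And>i. 0 \<le> p i"
  shows "0 \<le> mass p J"
  unfolding mass_def using assms by (intro sum_nonneg) auto

lemma mass_le_one:
  assumes "p \<in> std_simplex \<sigma>" "finite \<sigma>"
  shows "mass p J \<le> 1"
proof -
  have "mass p J \<le> mass p UNIV" using assms by (intro mass_mono) auto
  also have "\<dots> = 1"
    using assms mass_eq[OF assms(2) std_simplex_support[OF assms(1)], of UNIV] by (simp add: std_simplex_def)
  finally show ?thesis .
qed

lemma mass_insert:
  assumes "finite {i. p i \<noteq> 0}" "i \<notin> J"
  shows "mass p (insert i J) = p i + mass p J"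
proof -
  have "finite {k \<in> J. p k \<noteq> 0}" using assms(1) by (rule rev_finite_subset) auto
  moreover have "{k \<in> insert i J. p k \<noteq> 0} =
      (if p i = 0 then {k \<in> J. p k \<noteq> 0} else insert i {k \<in> J. p k \<noteq> 0})" by auto
  ultimately show ?thesis using assms(2) by (simp add: mass_def)
qed

lemma sum_pushforward:
  assumes S: "finite S" "{i. p i \<noteq> 0} \<subseteq> S" and W: "finite W" "\<rho> ` S \<subseteq> W"
  shows "sum (pushforward \<rho> p) W = sum p S"
proof -
  have "sum (pushforward \<rho> p) W = (\<Sum>k\<in>W. sum p {i \<in> S. \<rho> i = k})"
    unfolding pushforward_def using mass_eq[OF S] by (intro sum.cong) (auto intro!: arg_cong[of _ _ "sum p"])
  also have "\<dots> = sum p S"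
    using S W by (intro sum.group) auto
  finally show ?thesis .
qed

lemma pushforward_eq_0:
  assumes "{i. p i \<noteq> 0} \<subseteq> S" "k \<notin> \<rho> ` S"
  shows "pushforward \<rho> p k = 0"
proof -
  have "{i \<in> {i. \<rho> i = k}. p i \<noteq> 0} = {}" using assms by auto
  then show ?thesis unfolding pushforward_def mass_def by (metis sum.empty)
qed

lemma pushforward_simplex:
  assumes "p \<in> std_simplex \<sigma>" "finite \<sigma>"
  shows "pushforward \<rho> p \<in> std_simplex (\<rho> ` \<sigma>)"
proof -
  have "sum (pushforward \<rho> p) (\<rho> ` \<sigma>) = sum p \<sigma>"
    using assms std_simplex_support by (intro sum_pushforward) auto
  moreover have "0 \<le> pushforward \<rho> p k" for k
    unfolding pushforward_def using assms by (intro mass_nonneg) (auto simp: std_simplex_def)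
  moreover have "pushforward \<rho> p k = 0" if "k \<notin> \<rho> ` \<sigma>" for k
    using pushforward_eq_0[OF std_simplex_support[OF assms(1)] that] .
  ultimately show ?thesis using assms unfolding std_simplex_def by simp
qed

text \<open>
  The triangulated prism over a simplex: line up the masses of \<open>p\<close> along \<open>[0, 1]\<close> in the order
  given by the predecessor sets \<open>B\<close>. The mass in \<open>[0, t]\<close> is moved by the vertex map \<open>\<rho>\<close>,
  the rest stays. Only the vertex straddling \<open>t\<close> is split, so the support grows by at most one.
\<close>

definition predecessor_sets :: "('i \<Rightarrow> 'i set) \<Rightarrow> bool" where
  "predecessor_sets B \<longleftrightarrow> (\<forall>i. i \<notin> B i) \<and>
     (\<forall>i k. i \<noteq> k \<longrightarrow> insert i (B i) \<subseteq> B k \<or> insert k (B k) \<subseteq> B i)"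

text \<open>Strict initial segments of a linear order have this property, and the well-ordering
  theorem supplies an order. One order on all vertices makes the prism a single formula valid on
  every simplex.\<close>

lemma predecessor_sets_exist: "\<exists>B :: 'i \<Rightarrow> 'i set. predecessor_sets B"
proof -
  obtain r :: "'i rel" where "well_order_on UNIV r" using well_order_on by blast
  then have r: "refl_on UNIV r" "trans r" "antisym r" "total_on UNIV r"
    by (auto simp: well_order_on_def linear_order_on_def partial_order_on_def preorder_on_def)
  have below: "insert i {l. l \<noteq> i \<and> (l, i) \<in> r} \<subseteq> {l. l \<noteq> k \<and> (l, k) \<in> r}"
    if "(i, k) \<in> r" "i \<noteq> k" for i k
    using that transD[OF r(2) _ that(1)] antisymD[OF r(3) that(1)] by auto
  have "predecessor_sets (\<lambda>i. {k. k \<noteq> i \<and> (k, i) \<in> r})"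
    unfolding predecessor_sets_def
  proof (intro conjI allI impI)
    fix i k :: 'i assume "i \<noteq> k"
    then have "(i, k) \<in> r \<or> (k, i) \<in> r" using r(4) by (simp add: total_on_def)
    then show "insert i {l. l \<noteq> i \<and> (l, i) \<in> r} \<subseteq> {l. l \<noteq> k \<and> (l, k) \<in> r} \<or>
        insert k {l. l \<noteq> k \<and> (l, k) \<in> r} \<subseteq> {l. l \<noteq> i \<and> (l, i) \<in> r}"
      using below \<open>i \<noteq> k\<close> by (metis (no_types, lifting))
  qed simp
  then show ?thesis by blast
qed

text \<open>Vertex \<open>i\<close> occupies the interval from \<open>mass p (B i)\<close> to
  \<open>mass p (insert i (B i))\<close>; the difference of truncations is the length of the part
  below \<open>t\<close>.\<close>

definition moved :: "('i \<Rightarrow> 'i set) \<Rightarrow> real \<Rightarrow> ('i \<Rightarrow> real) \<Rightarrow> 'i \<Rightarrow> real" where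
  "moved B t p i = min t (mass p (insert i (B i))) - min t (mass p (B i))"

definition prism :: "('i \<Rightarrow> 'i set) \<Rightarrow> ('i \<Rightarrow> 'i) \<Rightarrow> real \<Rightarrow> ('i \<Rightarrow> real) \<Rightarrow> 'i \<Rightarrow> real" where
  "prism B \<rho> t p k = p k - moved B t p k + pushforward \<rho> (moved B t p) k"

context
  fixes B :: "'i \<Rightarrow> 'i set" and \<rho> :: "'i \<Rightarrow> 'i" and p :: "'i \<Rightarrow> real" and \<sigma> :: "'i set"
  assumes B: "predecessor_sets B" and p: "p \<in> std_simplex \<sigma>" and \<sigma>: "finite \<sigma>"
begin

lemma mass_insert_predecessors: "mass p (insert i (B i)) = p i + mass p (B i)"
  using B finite_subset[OF std_simplex_support[OF p] \<sigma>]
  by (intro mass_insert) (auto simp: predecessor_sets_def)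

lemma moved_bounds: "0 \<le> moved B t p i" "moved B t p i \<le> p i"
proof -
  have "0 \<le> p i" using p by (simp add: std_simplex_def)
  then show "0 \<le> moved B t p i" "moved B t p i \<le> p i"
    unfolding moved_def mass_insert_predecessors by linarith+
qed

lemma moved_support: "{i. moved B t p i \<noteq> 0} \<subseteq> \<sigma>"
proof
  fix i assume "i \<in> {i. moved B t p i \<noteq> 0}"
  then have "p i \<noteq> 0" using moved_bounds[of t i] by auto
  then show "i \<in> \<sigma>" using std_simplex_support[OF p] by auto
qed

lemma prism_0: "prism B \<rho> 0 p = p"
proof -
  have "min 0 (mass p J) = 0" for J
    using p by (intro min_absorb1 mass_nonneg) (auto simp: std_simplex_def)
  then have "moved B 0 p = (\<lambda>i. 0)" by (simp add: moved_def fun_eq_iff)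
  then show ?thesis by (simp add: prism_def pushforward_def mass_def fun_eq_iff)
qed

lemma prism_1: "prism B \<rho> 1 p = pushforward \<rho> p"
proof -
  have "moved B 1 p i = p i" for i
  proof -
    have m: "min 1 (mass p J) = mass p J" for J
      by (rule min_absorb2) (rule mass_le_one[OF p \<sigma>])
    show ?thesis
      using m[of "insert i (B i)"] m[of "B i"] mass_insert_predecessors[of i] unfolding moved_def by linarith
  qed
  then have "moved B 1 p = p" by (simp add: fun_eq_iff)
  then show ?thesis by (auto simp: prism_def)
qed

lemma prism_simplex:
  obtains \<tau> where "\<tau> \<subseteq> \<sigma> \<union> \<rho> ` \<sigma>" "card \<tau> \<le> card \<sigma> + 1" "prism B \<rho> t p \<in> std_simplex \<tau>"
proof -
  define U where "U = {i \<in> \<sigma>. moved B t p i \<noteq> p i}"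
  define V where "V = {i \<in> \<sigma>. moved B t p i \<noteq> 0}"
  have fin: "finite U" "finite V" using \<sigma> by (auto simp: U_def V_def)
  have straddle: "mass p (B i) < t" "t < mass p (insert i (B i))" if "i \<in> U \<inter> V" for i
  proof -
    have "0 \<le> p i" using p by (simp add: std_simplex_def)
    moreover have "moved B t p i \<noteq> p i" "moved B t p i \<noteq> 0"
      using that by (auto simp: U_def V_def)
    ultimately show "mass p (B i) < t" "t < mass p (insert i (B i))"
      unfolding moved_def mass_insert_predecessors by linarith+
  qed
  have "i = k" if "i \<in> U \<inter> V" "k \<in> U \<inter> V" for i k
  proof (rule ccontr)
    assume "i \<noteq> k"
    then consider "insert i (B i) \<subseteq> B k" | "insert k (B k) \<subseteq> B i"
      using B unfolding predecessor_sets_def by blast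
    then show False
      using straddle[OF that(1)] straddle[OF that(2)]
        mass_mono[OF p \<sigma>, of "insert i (B i)" "B k"] mass_mono[OF p \<sigma>, of "insert k (B k)" "B i"]
      by cases auto
  qed
  then have "card (U \<inter> V) \<le> 1"
    using fin by (auto simp: card_le_Suc0_iff_eq)
  moreover have "card (U \<union> V) \<le> card \<sigma>" using \<sigma> by (intro card_mono) (auto simp: U_def V_def)
  moreover have "card U + card V = card (U \<union> V) + card (U \<inter> V)" using fin by (rule card_Un_Int)
  moreover have "card (U \<union> \<rho> ` V) \<le> card U + card V"
    using card_Un_le[of U "\<rho> ` V"] card_image_le[OF fin(2), of \<rho>] by linarith
  ultimately have card: "card (U \<union> \<rho> ` V) \<le> card \<sigma> + 1" by linarith
  define W where "W = \<sigma> \<union> \<rho> ` \<sigma>"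
  have W: "finite W" using \<sigma> by (simp add: W_def)
  have sW: "sum q \<sigma> = sum q W" if "\<And>i. i \<notin> \<sigma> \<Longrightarrow> q i = 0" for q :: "'i \<Rightarrow> real"
    using W that by (intro sum.mono_neutral_left) (auto simp: W_def)
  have "sum (prism B \<rho> t p) W = sum p W - sum (moved B t p) W + sum (pushforward \<rho> (moved B t p)) W"
    by (simp add: prism_def[abs_def] sum.distrib sum_subtractf)
  also have "sum (pushforward \<rho> (moved B t p)) W = sum (moved B t p) \<sigma>"
    using W moved_support \<sigma> by (intro sum_pushforward) (auto simp: W_def)
  also have "sum (moved B t p) \<sigma> = sum (moved B t p) W"
    using moved_support[of t] by (intro sW) auto
  also have "sum p W = 1"
    using sW[of p] p by (simp add: std_simplex_def)
  finally have s1: "sum (prism B \<rho> t p) W = 1" by simp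
  have nn: "0 \<le> prism B \<rho> t p k" for k
  proof -
    have "0 \<le> pushforward \<rho> (moved B t p) k"
      unfolding pushforward_def using moved_bounds by (intro mass_nonneg)
    then show ?thesis using moved_bounds[of t k] unfolding prism_def by linarith
  qed
  have zero: "prism B \<rho> t p k = 0" if "k \<notin> U \<union> \<rho> ` V" for k
  proof -
    have "pushforward \<rho> (moved B t p) k = 0"
      using that moved_support[of t] by (intro pushforward_eq_0[of _ V]) (auto simp: V_def)
    moreover have "moved B t p k = p k"
      using that moved_support[of t] p by (cases "k \<in> \<sigma>") (auto simp: U_def std_simplex_def)
    ultimately show ?thesis by (simp add: prism_def)
  qed
  have sub: "U \<union> \<rho> ` V \<subseteq> W" by (auto simp: U_def V_def W_def)
  have "sum (prism B \<rho> t p) W = sum (prism B \<rho> t p) (U \<union> \<rho> ` V)"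
    using W sub zero by (intro sum.mono_neutral_right) auto
  then have "prism B \<rho> t p \<in> std_simplex (U \<union> \<rho> ` V)"
    using s1 nn zero by (simp add: std_simplex_def)
  then show ?thesis using that card sub unfolding W_def by blast
qed

end

lemma pushforward_diff:
  assumes "finite S" "card S \<le> N" "{i. p i \<noteq> 0} \<subseteq> S"
    and "finite T" "card T \<le> N" "{i. q i \<noteq> 0} \<subseteq> T"
    and "\<And>i. \<bar>p i - q i\<bar> \<le> \<delta>"
  shows "\<bar>pushforward \<rho> p k - pushforward \<rho> q k\<bar> \<le> 2 * real N * \<delta>"
  unfolding pushforward_def by (rule mass_diff[OF assms])

lemma prism_diff:
  assumes B: "predecessor_sets B"
    and p: "p \<in> std_simplex \<sigma>" "finite \<sigma>" "card \<sigma> \<le> N"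
    and q: "q \<in> std_simplex \<tau>" "finite \<tau>" "card \<tau> \<le> N"
    and N: "1 \<le> N" and d: "\<And>i. \<bar>p i - q i\<bar> \<le> \<delta>" and st: "\<bar>s - t\<bar> \<le> \<epsilon>"
  shows "\<bar>prism B \<rho> s p k - prism B \<rho> t q k\<bar> \<le> \<delta> + 3 * real N * (4 * real N * \<delta> + 2 * \<epsilon>)"
proof -
  \<comment> \<open>Two truncated masses, each changing by at most
    \<open>\<epsilon> + 2 * N * \<delta>\<close>. Pushing forward multiplies by another
    \<open>2 * N\<close>.\<close>
  define \<mu> where "\<mu> = 4 * real N * \<delta> + 2 * \<epsilon>"
  have d0: "0 \<le> \<delta>" using sup_bound_nonneg[of p q] d by blast
  have e0: "0 \<le> \<epsilon>" using st by linarith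
  have mass: "\<bar>mass p J - mass q J\<bar> \<le> 2 * real N * \<delta>" for J
    using p q std_simplex_support d by (intro mass_diff[of \<sigma> N p \<tau> q]) auto
  have m: "\<bar>moved B s p i - moved B t q i\<bar> \<le> \<mu>" for i
  proof -
    have min: "\<bar>min s a - min t b\<bar> \<le> \<bar>s - t\<bar> + \<bar>a - b\<bar>" for a b :: real
      by linarith
    have "\<bar>moved B s p i - moved B t q i\<bar>
        \<le> \<bar>min s (mass p (insert i (B i))) - min t (mass q (insert i (B i)))\<bar>
          + \<bar>min s (mass p (B i)) - min t (mass q (B i))\<bar>"
      unfolding moved_def by linarith
    also have "\<dots> \<le> (\<epsilon> + 2 * real N * \<delta>) + (\<epsilon> + 2 * real N * \<delta>)"
      using min[of "mass p (insert i (B i))" "mass q (insert i (B i))"] min[of "mass p (B i)" "mass q (B i)"]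
        mass[of "insert i (B i)"] mass[of "B i"] st by linarith
    finally show ?thesis unfolding \<mu>_def by linarith
  qed
  have "\<bar>pushforward \<rho> (moved B s p) k - pushforward \<rho> (moved B t q) k\<bar> \<le> 2 * real N * \<mu>"
    by (rule pushforward_diff[OF p(2,3) moved_support[OF B p(1,2)] q(2,3) moved_support[OF B q(1,2)] m])
  moreover have "\<mu> \<le> real N * \<mu>"
    using N d0 e0 mult_right_mono[of 1 "real N" \<mu>] by (simp add: \<mu>_def)
  moreover have "\<bar>prism B \<rho> s p k - prism B \<rho> t q k\<bar> \<le> \<bar>p k - q k\<bar>
      + \<bar>moved B s p k - moved B t q k\<bar>
      + \<bar>pushforward \<rho> (moved B s p) k - pushforward \<rho> (moved B t q) k\<bar>"
    unfolding prism_def by linarith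
  ultimately have "\<bar>prism B \<rho> s p k - prism B \<rho> t q k\<bar> \<le> \<delta> + 3 * real N * \<mu>"
    using d[of k] m[of k] by linarith
  then show ?thesis by (simp add: \<mu>_def)
qed

section \<open>Partitions of unity at all scales\<close>

lemma diameter_le_dist:
  assumes "0 \<le> d" "\<And>u v. \<lbrakk>u \<in> D; v \<in> D\<rbrakk> \<Longrightarrow> dist u v \<le> d"
  shows "diameter D \<le> d"
  unfolding diameter_def using assms by (auto intro!: cSUP_least)

lemma ex_dist_less_if_infdist_less:
  assumes "infdist x U < r" "U \<noteq> {}"
  shows "\<exists>b\<in>U. dist x b < r"
proof (rule ccontr)
  assume "\<not> ?thesis"
  then have "r \<le> infdist x U"
    unfolding infdist_notempty[OF assms(2)] using assms(2) by (intro cINF_greatest) auto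
  with assms(1) show False by simp
qed

text \<open>Bumps of radius \<open>2 * s\<close> around the members, divided by their sum. At height
  at most \<open>s\<close> the gap between \<open>s\<close> and \<open>2 * s\<close> bounds the sum
  below by \<open>s\<close>.\<close>

lemma partition_of_unity_of_cover:
  fixes U :: "'i \<Rightarrow> 'a::metric_space set" and J :: "'i set" and s :: real
  defines "nbr x \<equiv> {i \<in> J. \<exists>b\<in>U i. dist x b < 2 * s}"
  assumes s: "0 < s" and N: "1 \<le> N" and fin: "\<And>x. finite (nbr x)" "\<And>x. card (nbr x) \<le> N"
    and A: "(\<Union>i\<in>J. U i) = A" "A \<noteq> {}"
  shows "\<exists>\<psi>. (\<forall>x. infdist x A \<le> s \<longrightarrow> \<psi> x \<in> std_simplex (nbr x)) \<and>
     (\<forall>x x' i. infdist x A \<le> s \<and> infdist x' A \<le> s \<longrightarrow>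
       \<bar>\<psi> x i - \<psi> x' i\<bar> \<le> 3 * real N / s * dist x x')"
proof -
  \<comment> \<open>Empty members are excluded because \<open>infdist\<close> to the empty set is 0,
    which would give them a full bump.\<close>
  define \<phi> where "\<phi> = (\<lambda>x i. if i \<in> J \<and> U i \<noteq> {} then max 0 (2 * s - infdist x (U i)) else 0)"
  define tot where "tot = (\<lambda>x. sum (\<phi> x) (nbr x))"
  have \<phi>0: "0 \<le> \<phi> x i" for x i by (simp add: \<phi>_def)
  have supp: "{i. \<phi> x i \<noteq> 0} \<subseteq> nbr x" for x
  proof
    fix i assume "i \<in> {i. \<phi> x i \<noteq> 0}"
    then have "i \<in> J" "U i \<noteq> {}" "infdist x (U i) < 2 * s"
      by (auto simp: \<phi>_def max_def split: if_splits)
    then show "i \<in> nbr x"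
      using ex_dist_less_if_infdist_less unfolding nbr_def by blast
  qed
  have \<phi>tot: "\<phi> x i \<le> tot x" for x i
  proof (cases "i \<in> nbr x")
    case True
    then show ?thesis unfolding tot_def using fin \<phi>0 by (intro member_le_sum) auto
  next
    case False
    then have "\<phi> x i = 0" using supp[of x] by blast
    then show ?thesis unfolding tot_def using \<phi>0 by (simp add: sum_nonneg)
  qed
  have tot: "s \<le> tot x" if "infdist x A \<le> s" for x
  proof -
    \<comment> \<open>The infimum \<open>infdist x A\<close> need not be attained, so the bound is
      shown for every \<open>a\<close>; a member containing \<open>a\<close> already has a large
      enough bump.\<close>
    have "2 * s - tot x \<le> dist x a" if a: "a \<in> A" for a
    proof -
      obtain i where i: "i \<in> J" "a \<in> U i" using a A by blast
      then have "2 * s - dist x a \<le> \<phi> x i"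
        using infdist_le[OF i(2), of x] by (auto simp: \<phi>_def)
      with \<phi>tot[of x i] show ?thesis by linarith
    qed
    then have "2 * s - tot x \<le> infdist x A"
      unfolding infdist_notempty[OF A(2)] using A(2) by (intro cINF_greatest)
    with that show ?thesis by linarith
  qed
  have \<phi>diff: "\<bar>\<phi> x i - \<phi> x' i\<bar> \<le> dist x x'" for x x' i
    using infdist_triangle_abs[of x "U i" x'] by (auto simp: \<phi>_def max_def)
  have totdiff: "\<bar>tot x - tot x'\<bar> \<le> 2 * real N * dist x x'" for x x'
    using mass_diff[OF fin[of x] supp fin[of x'] supp \<phi>diff, of UNIV]
    by (simp add: tot_def mass_eq[OF fin(1) supp])
  show ?thesis
  proof (intro exI[of _ "\<lambda>x i. \<phi> x i / tot x"] conjI allI impI)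
    fix x assume x: "infdist x A \<le> s"
    then have "0 < tot x" using tot s by force
    moreover have "\<phi> x i = 0" if "i \<notin> nbr x" for i
      using that supp[of x] by blast
    ultimately show "(\<lambda>i. \<phi> x i / tot x) \<in> std_simplex (nbr x)"
      using \<phi>0 by (simp add: std_simplex_def sum_divide_distrib[symmetric] tot_def)
  next
    fix x x' i assume "infdist x A \<le> s \<and> infdist x' A \<le> s"
    then have x: "infdist x A \<le> s" and x': "infdist x' A \<le> s" by auto
    define T where "T = tot x"
    define T' where "T' = tot x'"
    have T: "s \<le> T" "s \<le> T'" "0 < T" "0 < T'"
      using tot[OF x] tot[OF x'] s by (auto simp: T_def T'_def)
    \<comment> \<open>In this form the variation of the sum is multiplied only by a quotient in
      \<open>[0, 1]\<close>, and a single division by \<open>T \<ge> s\<close> remains.\<close>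
    have "\<phi> x i / T - \<phi> x' i / T' = ((\<phi> x i - \<phi> x' i) + \<phi> x' i / T' * (T' - T)) / T"
      using T by (simp add: field_simps)
    also have "\<bar>\<dots>\<bar> = \<bar>(\<phi> x i - \<phi> x' i) + \<phi> x' i / T' * (T' - T)\<bar> / T"
      using T by simp
    also have "\<dots> \<le> (dist x x' + 2 * real N * dist x x') / s"
    proof (intro frac_le)
      have q: "0 \<le> \<phi> x' i / T'" "\<phi> x' i / T' \<le> 1"
        using \<phi>tot[of x' i] \<phi>0[of x' i] T by (auto simp: T'_def)
      have "\<bar>\<phi> x' i / T' * (T' - T)\<bar> = \<phi> x' i / T' * \<bar>T' - T\<bar>"
        using q(1) by (simp only: abs_mult abs_of_nonneg)
      also have "\<dots> \<le> 1 * (2 * real N * dist x x')"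
        using q totdiff[of x x'] by (intro mult_mono) (auto simp: T_def T'_def abs_minus_commute)
      finally have "\<bar>\<phi> x' i / T' * (T' - T)\<bar> \<le> 2 * real N * dist x x'" by simp
      then show "\<bar>\<phi> x i - \<phi> x' i + \<phi> x' i / T' * (T' - T)\<bar> \<le> dist x x' + 2 * real N * dist x x'"
        using \<phi>diff[of x i x'] by linarith
    qed (use T s in auto)
    also have "\<dots> \<le> 3 * real N * dist x x' / s"
    proof (intro divide_right_mono)
      have "dist x x' \<le> real N * dist x x'"
        using N mult_right_mono[of 1 "real N" "dist x x'"] by simp
      then show "dist x x' + 2 * real N * dist x x' \<le> 3 * real N * dist x x'" by linarith
    qed (use s in auto)
    finally show "\<bar>\<phi> x i / tot x - \<phi> x' i / tot x'\<bar> \<le> 3 * real N / s * dist x x'"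
      by (simp add: T_def T'_def)
  qed
qed

text \<open>Members within \<open>2 * s\<close> of \<open>x\<close> are those meeting a subset of
  \<open>A\<close> of diameter at most \<open>4 * s\<close>. Multiplicity asks for a strictly
  smaller diameter, hence 5.\<close>

lemma multiplicity_ball:
  fixes A :: "'a::metric_space set"
  assumes m: "multiplicity_at_most (5 * s) N A \<B>" and "\<B> \<subseteq> Pow A" and s: "0 < s"
  shows "finite {B\<in>\<B>. \<exists>b\<in>B. dist x b < 2 * s}" "card {B\<in>\<B>. \<exists>b\<in>B. dist x b < 2 * s} \<le> N"
proof -
  define D where "D = {a\<in>A. dist x a < 2 * s}"
  have b: "bounded D" unfolding bounded_def D_def using less_imp_le by blast
  have "dist u v \<le> 4 * s" if "u \<in> D" "v \<in> D" for u v
    using that dist_triangle3[of u v x] by (auto simp: D_def)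
  then have "diameter D \<le> 4 * s"
    using s by (intro diameter_le_dist) auto
  then have d: "diameter D < 5 * s" using s by linarith
  have eq: "{B\<in>\<B>. B \<inter> D \<noteq> {}} = {B\<in>\<B>. \<exists>b\<in>B. dist x b < 2 * s}"
    using assms(2) by (auto simp: D_def)
  have "D \<subseteq> A" by (auto simp: D_def)
  from m[unfolded multiplicity_at_most_def, rule_format, OF this conjI[OF b d]]
  show "finite {B\<in>\<B>. \<exists>b\<in>B. dist x b < 2 * s}" "card {B\<in>\<B>. \<exists>b\<in>B. dist x b < 2 * s} \<le> N"
    unfolding eq by auto
qed

lemma nagata_scales:
  fixes A :: "'a::metric_space set" and n :: nat and c :: real and S :: "int \<Rightarrow> real"
  assumes nag: "nagata n c A" and c: "0 < c" and A: "A \<noteq> {}"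
    and S: "\<And>j. 0 < S j" "\<And>j. S (j + 1) = 3 * (c + 1) * S j"
  obtains nbr :: "int \<Rightarrow> 'a \<Rightarrow> (int \<times> 'a set) set" and \<psi> and \<rho> and a
  where "\<And>j x. finite (nbr j x)" "\<And>j x. card (nbr j x) \<le> n + 1"
    "\<And>j x. infdist x A \<le> S j \<Longrightarrow> \<psi> j x \<in> std_simplex (nbr j x)"
    "\<And>j x x' i. \<lbrakk>infdist x A \<le> S j; infdist x' A \<le> S j\<rbrakk> \<Longrightarrow>
       \<bar>\<psi> j x i - \<psi> j x' i\<bar> \<le> 3 * real (n + 1) / S j * dist x x'"
    "\<And>j x. \<rho> ` nbr j x \<subseteq> nbr (j + 1) x"
    "\<And>i. a i \<in> A" "\<And>j x i. i \<in> nbr j x \<Longrightarrow> dist x (a i) \<le> 5 * (c + 1) * S j"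
proof -
  have "\<forall>j. \<exists>\<B>. \<B> \<subseteq> Pow A \<and> \<Union>\<B> = A \<and> multiplicity_at_most (5 * S j) (n + 1) A \<B> \<and>
      (\<forall>B\<in>\<B>. bounded B \<and> diameter B \<le> c * (5 * S j))"
    using nag S(1) unfolding nagata_def by simp
  then obtain Cov where "\<forall>j. Cov j \<subseteq> Pow A \<and> \<Union>(Cov j) = A \<and>
      multiplicity_at_most (5 * S j) (n + 1) A (Cov j) \<and>
      (\<forall>B\<in>Cov j. bounded B \<and> diameter B \<le> c * (5 * S j))"
    unfolding choice_iff ..
  then have Cov: "\<And>j. Cov j \<subseteq> Pow A" "\<And>j. \<Union>(Cov j) = A"
      "\<And>j. multiplicity_at_most (5 * S j) (n + 1) A (Cov j)"
      "\<And>j B. B \<in> Cov j \<Longrightarrow> bounded B" "\<And>j B. B \<in> Cov j \<Longrightarrow> diameter B \<le> c * (5 * S j)"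
    by auto
  \<comment> \<open>Members are tagged with their scale: a set occurring in several covers gives
    several vertices, and the vertex map can read off the scale.\<close>
  define J where "J = (\<lambda>j. {j} \<times> Cov j)"
  define nbr where "nbr = (\<lambda>j x. {i \<in> J j. \<exists>b\<in>snd i. dist x b < 2 * S j})"
  have nbr_image: "nbr j x = Pair j ` {B\<in>Cov j. \<exists>b\<in>B. dist x b < 2 * S j}" for j x
    unfolding nbr_def J_def by (auto simp: image_iff)
  have fin: "finite (nbr j x)" for j x
    unfolding nbr_image using multiplicity_ball(1)[OF Cov(3,1) S(1)] by blast
  have card: "card (nbr j x) \<le> n + 1" for j x
    unfolding nbr_image
    using multiplicity_ball[OF Cov(3,1) S(1), of j x] card_image_le order_trans by blast
  have "\<exists>\<psi>. (\<forall>x. infdist x A \<le> S j \<longrightarrow> \<psi> x \<in> std_simplex (nbr j x)) \<and>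
     (\<forall>x x' i. infdist x A \<le> S j \<and> infdist x' A \<le> S j \<longrightarrow>
       \<bar>\<psi> x i - \<psi> x' i\<bar> \<le> 3 * real (n + 1) / S j * dist x x')" for j
  proof -
    have "(\<Union>i\<in>J j. snd i) = A" using Cov(2)[of j] by (auto simp: J_def)
    then show ?thesis
      using S(1)[of j] A fin[of j] card[of j]
      unfolding nbr_def by (intro partition_of_unity_of_cover) auto
  qed
  then have "\<forall>j. \<exists>\<psi>. (\<forall>x. infdist x A \<le> S j \<longrightarrow> \<psi> x \<in> std_simplex (nbr j x)) \<and>
     (\<forall>x x' i. infdist x A \<le> S j \<and> infdist x' A \<le> S j \<longrightarrow>
       \<bar>\<psi> x i - \<psi> x' i\<bar> \<le> 3 * real (n + 1) / S j * dist x x')" by blast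
  then obtain \<psi> where "\<forall>j. (\<forall>x. infdist x A \<le> S j \<longrightarrow> \<psi> j x \<in> std_simplex (nbr j x)) \<and>
     (\<forall>x x' i. infdist x A \<le> S j \<and> infdist x' A \<le> S j \<longrightarrow>
       \<bar>\<psi> j x i - \<psi> j x' i\<bar> \<le> 3 * real (n + 1) / S j * dist x x')"
    unfolding choice_iff ..
  then have \<psi>: "\<And>j x. infdist x A \<le> S j \<Longrightarrow> \<psi> j x \<in> std_simplex (nbr j x)"
    "\<And>j x x' i. \<lbrakk>infdist x A \<le> S j; infdist x' A \<le> S j\<rbrakk> \<Longrightarrow>
       \<bar>\<psi> j x i - \<psi> j x' i\<bar> \<le> 3 * real (n + 1) / S j * dist x x'"
    by blast+
  \<comment> \<open>The second branch is a default for indices that are no non-empty member, so that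
    \<open>a i \<in> A\<close> holds for every \<open>i\<close>.\<close>
  define a where "a = (\<lambda>i :: int \<times> 'a set. if snd i \<inter> A \<noteq> {} then SOME z. z \<in> snd i \<inter> A else SOME z. z \<in> A)"
  have aA: "a i \<in> A" for i
    unfolding a_def using A some_in_eq[of "snd i \<inter> A"] some_in_eq[of A] by auto
  have aB: "a (j, B) \<in> B" if "B \<in> Cov j" "B \<noteq> {}" for j B
  proof -
    have "B \<inter> A \<noteq> {}" using that Cov(1)[of j] by auto
    then show ?thesis using some_in_eq[of "B \<inter> A"] by (simp add: a_def)
  qed
  define \<rho> where "\<rho> = (\<lambda>i :: int \<times> 'a set. (fst i + 1, SOME P. P \<in> Cov (fst i + 1) \<and> a i \<in> P))"
  have \<rho>P: "snd (\<rho> i) \<in> Cov (fst i + 1)" "a i \<in> snd (\<rho> i)" for i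
  proof -
    have "\<exists>P. P \<in> Cov (fst i + 1) \<and> a i \<in> P" using aA[of i] Cov(2)[of "fst i + 1"] by blast
    from someI_ex[OF this] show "snd (\<rho> i) \<in> Cov (fst i + 1)" "a i \<in> snd (\<rho> i)"
      by (auto simp: \<rho>_def)
  qed
  have near: "dist x (a i) < 2 * S j + 5 * c * S j" if "i \<in> nbr j x" for i j x
  proof -
    obtain B b where i: "i = (j, B)" and B: "B \<in> Cov j" and b: "b \<in> B" "dist x b < 2 * S j"
      using \<open>i \<in> nbr j x\<close> by (auto simp: nbr_def J_def)
    have "a i \<in> B" using aB[OF B] b i by auto
    then have "dist b (a i) \<le> c * (5 * S j)"
      using diameter_bounded_bound[OF Cov(4)[OF B] b(1)] Cov(5)[OF B] order_trans by blast
    then show ?thesis using dist_triangle[of x "a i" b] b(2) by (simp add: mult_ac)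
  qed
  \<comment> \<open>The scale ratio enters here: \<open>2 + 5 * c \<le> 6 * (c + 1)\<close>. Hence
    the member chosen by \<open>\<rho>\<close>, which contains \<open>a i\<close>, is a neighbour at
    the next scale.\<close>
  have r: "2 * S j + 5 * c * S j \<le> 2 * S (j + 1)" for j
    unfolding S(2) using S(1)[of j] c by (simp add: algebra_simps)
  show ?thesis
  proof (rule that[of nbr \<psi> \<rho> a, OF fin card \<psi>])
    show "\<rho> ` nbr j x \<subseteq> nbr (j + 1) x" for j x
    proof
      fix k assume "k \<in> \<rho> ` nbr j x"
      then obtain i where i: "i \<in> nbr j x" "k = \<rho> i" by auto
      then have "fst i = j" by (auto simp: nbr_def J_def)
      then have "k \<in> J (j + 1)" using \<rho>P(1)[of i] i(2) by (cases k) (auto simp: J_def \<rho>_def)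
      moreover have "dist x (a i) < 2 * S (j + 1)" using near[OF i(1)] r[of j] by linarith
      ultimately show "k \<in> nbr (j + 1) x" using \<rho>P(2)[of i] i(2) unfolding nbr_def by blast
    qed
    show "a i \<in> A" for i by (rule aA)
    show "dist x (a i) \<le> 5 * (c + 1) * S j" if "i \<in> nbr j x" for i j x
      using near[OF that] S(1)[of j] by (simp add: algebra_simps)
  qed auto
qed

section \<open>Interpolation between consecutive scales\<close>

locale scale_system =
  fixes n :: nat and c :: real and A :: "'a::metric_space set" and S :: "int \<Rightarrow> real"
    and nbr :: "int \<Rightarrow> 'a \<Rightarrow> 'i set" and \<psi> :: "int \<Rightarrow> 'a \<Rightarrow> 'i \<Rightarrow> real"
    and \<rho> :: "'i \<Rightarrow> 'i" and a :: "'i \<Rightarrow> 'a" and B :: "'i \<Rightarrow> 'i set"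
  assumes c: "0 < c" and S_def: "S = (\<lambda>j. (3 * (c + 1)) powi j)"
    and nbr: "finite (nbr j x)" "card (nbr j x) \<le> n + 1" "\<rho> ` nbr j x \<subseteq> nbr (j + 1) x"
    and \<psi>: "infdist x A \<le> S j \<Longrightarrow> \<psi> j x \<in> std_simplex (nbr j x)"
    and \<psi>_diff: "\<lbrakk>infdist x A \<le> S j; infdist x' A \<le> S j\<rbrakk> \<Longrightarrow>
       \<bar>\<psi> j x i - \<psi> j x' i\<bar> \<le> 3 * real (n + 1) / S j * dist x x'"
    and near: "i \<in> nbr j x \<Longrightarrow> dist x (a i) \<le> 5 * (c + 1) * S j"
    and B: "predecessor_sets B"
begin

lemma S_pos: "0 < S j"
  using c by (simp add: S_def)

lemma S_Suc: "S (j + 1) = 3 * (c + 1) * S j"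
  using c by (simp add: S_def power_int_add)

lemma S_mono: "i \<le> j \<Longrightarrow> S i \<le> S j"
  using c by (simp add: S_def power_int_increasing)

lemma S_step: "3 * S (j - 1) \<le> S j"
proof -
  have "3 * S (j - 1) \<le> 3 * (c + 1) * S (j - 1)"
    using c S_pos[of "j - 1"] by (intro mult_right_mono) auto
  then show ?thesis using S_Suc[of "j - 1"] by simp
qed

definition level :: "real \<Rightarrow> int" where
  "level h = \<lfloor>log (3 * (c + 1)) h\<rfloor> + 1"

lemma level:
  assumes "0 < h"
  shows "S (level h - 1) \<le> h" "h < S (level h)"
proof -
  define b where "b = 3 * (c + 1)"
  have b: "1 < b" using c by (simp add: b_def)
  have S: "S j = b powr real_of_int j" for j
    using b by (simp add: S_def b_def powr_real_of_int')
  have h: "h = b powr log b h" using b assms by simp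
  have "b powr real_of_int (level h - 1) \<le> b powr log b h"
    using b by (intro powr_mono) (auto simp: level_def b_def)
  then show "S (level h - 1) \<le> h" unfolding S using h by simp
  have "b powr log b h < b powr real_of_int (level h)"
    using b by (intro powr_less_mono) (auto simp: level_def b_def)
  then show "h < S (level h)" unfolding S using h by simp
qed

text \<open>
  While the height \<open>h\<close> runs through \<open>[S (j - 1), S j]\<close>, the point first slides from the pushed
  partition of unity of scale \<open>j\<close> to the one of scale \<open>j + 1\<close>, both of which live in one simplex,
  and is then pushed through the prism to scale \<open>j + 2\<close>.
\<close>

definition slide :: "int \<Rightarrow> real \<Rightarrow> real" where
  "slide j h = max 0 (min 1 (2 * (h - S (j - 1)) / (S j - S (j - 1))))"

definition push :: "int \<Rightarrow> real \<Rightarrow> real" where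
  "push j h = max 0 (min 1 (2 * (h - S (j - 1)) / (S j - S (j - 1)) - 1))"

definition base :: "int \<Rightarrow> 'a \<Rightarrow> real \<Rightarrow> 'i \<Rightarrow> real" where
  "base j x h k = (1 - slide j h) * pushforward \<rho> (\<psi> j x) k + slide j h * \<psi> (j + 1) x k"

definition interp :: "int \<Rightarrow> 'a \<Rightarrow> real \<Rightarrow> 'i \<Rightarrow> real" where
  "interp j x h = prism B \<rho> (push j h) (base j x h)"

lemma ramp_diff:
  assumes "\<bar>h - h'\<bar> \<le> e"
  shows "\<bar>slide j h - slide j h'\<bar> \<le> 3 * (e / S j)" "\<bar>push j h - push j h'\<bar> \<le> 3 * (e / S j)"
proof -
  define w where "w = S j - S (j - 1)"
  \<comment> \<open>The ratio of scales is at least 3, so ramps of slope \<open>2 / w\<close> have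
    slope at most \<open>3 / S j\<close>, free of \<open>c\<close>.\<close>
  have w: "2 / 3 * S j \<le> w" using S_step[of j] by (simp add: w_def)
  have S: "0 < S j" by (rule S_pos)
  have e: "0 \<le> e" using assms by linarith
  have w0: "0 < w" using w S by linarith
  have "2 * (h - S (j - 1)) / w - 2 * (h' - S (j - 1)) / w = 2 * (h - h') / w"
    using w0 by (simp add: field_simps)
  then have "\<bar>2 * (h - S (j - 1)) / w - 2 * (h' - S (j - 1)) / w\<bar> = 2 * \<bar>h - h'\<bar> / w"
    using w0 by (simp only: abs_divide abs_mult abs_numeral abs_of_pos)
  also have "\<dots> \<le> 2 * e / (2 / 3 * S j)"
    using assms w S e by (intro frac_le) auto
  also have "\<dots> = 3 * (e / S j)" by simp
  finally have *: "\<bar>2 * (h - S (j - 1)) / w - 2 * (h' - S (j - 1)) / w\<bar> \<le> 3 * (e / S j)" .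
  have clamp: "\<bar>max 0 (min 1 u) - max 0 (min 1 v)\<bar> \<le> \<bar>u - v\<bar>" for u v :: real
    by linarith
  show "\<bar>slide j h - slide j h'\<bar> \<le> 3 * (e / S j)"
    unfolding slide_def w_def[symmetric] using clamp * by (rule order_trans)
  show "\<bar>push j h - push j h'\<bar> \<le> 3 * (e / S j)"
    unfolding push_def w_def[symmetric] by (rule order_trans[OF clamp]) (use * in simp)
qed

lemma ramp_bounds: "0 \<le> slide j h" "slide j h \<le> 1"
  by (auto simp: slide_def)

lemma ramp_ends: "slide j (S (j - 1)) = 0" "push j (S (j - 1)) = 0" "slide j (S j) = 1" "push j (S j) = 1"
proof -
  have "S j - S (j - 1) \<noteq> 0" using S_step[of j] S_pos[of "j - 1"] by linarith
  then have "2 * (S j - S (j - 1)) / (S j - S (j - 1)) = 2" by (rule nonzero_mult_div_cancel_right)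
  then show "slide j (S (j - 1)) = 0" "push j (S (j - 1)) = 0" "slide j (S j) = 1" "push j (S j) = 1"
    unfolding slide_def push_def by (simp_all del: right_diff_distrib_numeral)
qed

lemma pushed_simplex:
  assumes "infdist x A \<le> S j"
  shows "pushforward \<rho> (\<psi> j x) \<in> std_simplex (nbr (j + 1) x)"
  using pushforward_simplex[OF \<psi>[OF assms] nbr(1)] std_simplex_mono[OF nbr(1,3)] by blast

lemma next_simplex:
  assumes "infdist x A \<le> S j"
  shows "\<psi> (j + 1) x \<in> std_simplex (nbr (j + 1) x)"
  using assms S_mono[of j "j + 1"] by (intro \<psi>) auto

lemma base_simplex:
  assumes "infdist x A \<le> S j"
  shows "base j x h \<in> std_simplex (nbr (j + 1) x)"
  using pushed_simplex[OF assms] next_simplex[OF assms] ramp_bounds[of j h]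
  by (simp add: std_simplex_def base_def sum.distrib sum_distrib_left[symmetric])

lemma base_diff:
  assumes x: "infdist x A \<le> S j" and x': "infdist x' A \<le> S j"
    and e: "dist x x' \<le> e" "\<bar>h - h'\<bar> \<le> e"
  shows "\<bar>base j x h k - base j x' h' k\<bar> \<le> 12 * real (n + 1) ^ 2 * (e / S j)"
proof -
  define N where "N = real (n + 1)"
  define E where "E = e / S j"
  define u where "u = pushforward \<rho> (\<psi> j x) k"
  define u' where "u' = pushforward \<rho> (\<psi> j x') k"
  define v where "v = \<psi> (j + 1) x k"
  define v' where "v' = \<psi> (j + 1) x' k"
  define s where "s = slide j h"
  define s' where "s' = slide j h'"
  have N1: "1 \<le> N" by (simp add: N_def)
  then have N: "1 \<le> N" "N \<le> N ^ 2" "1 \<le> N ^ 2" by (auto intro: self_le_power one_le_power)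
  have e0: "0 \<le> e" using zero_le_dist e(1) by (rule order_trans)
  have E0: "0 \<le> E" using e0 S_pos[of j] by (simp add: E_def)
  have \<psi>d: "\<bar>\<psi> j x i - \<psi> j x' i\<bar> \<le> 3 * N * E" for i
  proof -
    have "3 * real (n + 1) / S j * dist x x' \<le> 3 * real (n + 1) / S j * e"
      using e S_pos[of j] by (intro mult_left_mono) auto
    then show ?thesis using \<psi>_diff[OF x x', of i] by (simp add: N_def E_def)
  qed
  have "\<bar>u - u'\<bar> \<le> 2 * real (n + 1) * (3 * N * E)"
    unfolding u_def u'_def using \<psi>[OF x] \<psi>[OF x']
    by (intro pushforward_diff[OF nbr(1,2)[of j x] _ nbr(1,2)[of j x'] _ \<psi>d])
      (simp_all add: std_simplex_support)
  then have uu: "\<bar>u - u'\<bar> \<le> 6 * N ^ 2 * E"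
    unfolding N_def[symmetric] by (simp add: power2_eq_square mult_ac)
  have "\<bar>v - v'\<bar> \<le> 3 * real (n + 1) / S (j + 1) * dist x x'"
    unfolding v_def v'_def using x x' S_mono[of j "j + 1"] by (intro \<psi>_diff) auto
  also have "\<dots> \<le> 3 * real (n + 1) / S j * e"
    using e e0 S_pos S_mono[of j "j + 1"] by (intro mult_mono divide_left_mono mult_pos_pos) (auto intro: less_imp_le)
  also have "\<dots> = 3 * N * E" by (simp add: N_def E_def)
  also have "\<dots> \<le> 3 * N ^ 2 * E" using N E0 by (intro mult_right_mono) auto
  finally have vv: "\<bar>v - v'\<bar> \<le> 3 * N ^ 2 * E" .
  have s01: "0 \<le> s" "s \<le> 1" using ramp_bounds by (auto simp: s_def)
  have uv: "0 \<le> u'" "u' \<le> 1" "0 \<le> v'" "v' \<le> 1"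
    using pushed_simplex[OF x'] next_simplex[OF x'] std_simplex_le_one[OF nbr(1)]
    unfolding u'_def v'_def by (auto simp: std_simplex_def)
  have "\<bar>s - s'\<bar> \<le> 3 * E" using ramp_diff(1)[OF e(2)] by (simp add: s_def s'_def E_def)
  moreover have "3 * E \<le> 3 * N ^ 2 * E" using N E0 mult_right_mono[of 3 "3 * N ^ 2" E] by simp
  ultimately have ss: "\<bar>s - s'\<bar> \<le> 3 * N ^ 2 * E" by linarith
  \<comment> \<open>Product rule for a convex combination; the three terms contribute 6, 3 and 3 to
    the constant 12.\<close>
  have "base j x h k - base j x' h' k = (1 - s) * (u - u') + s * (v - v') + (s - s') * (v' - u')"
    by (simp add: base_def s_def s'_def u_def u'_def v_def v'_def algebra_simps)
  also have "\<bar>\<dots>\<bar> \<le> \<bar>(1 - s) * (u - u')\<bar> + \<bar>s * (v - v')\<bar> + \<bar>(s - s') * (v' - u')\<bar>"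
    by linarith
  also have "\<dots> = (1 - s) * \<bar>u - u'\<bar> + s * \<bar>v - v'\<bar> + \<bar>s - s'\<bar> * \<bar>v' - u'\<bar>"
    using s01 by (simp add: abs_mult)
  also have "\<dots> \<le> 1 * (6 * N ^ 2 * E) + 1 * (3 * N ^ 2 * E) + (3 * N ^ 2 * E) * 1"
    using s01 uv uu vv ss N E0 by (intro add_mono mult_mono) auto
  finally have "\<bar>base j x h k - base j x' h' k\<bar> \<le> 12 * N ^ 2 * E" by (simp add: mult_ac)
  then show ?thesis by (simp only: N_def E_def)
qed

lemma interp_diff:
  assumes x: "infdist x A \<le> S j" and x': "infdist x' A \<le> S j"
    and e: "dist x x' \<le> e" "\<bar>h - h'\<bar> \<le> e"
  shows "\<bar>interp j x h k - interp j x' h' k\<bar> \<le> 200 * real (n + 1) ^ 4 * (e / S j)"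
proof -
  define N where "N = real (n + 1)"
  define E where "E = e / S j"
  have E0: "0 \<le> E" using order_trans[OF zero_le_dist e(1)] S_pos[of j] by (simp add: E_def)
  have N: "1 \<le> N" by (simp add: N_def)
  have "\<bar>interp j x h k - interp j x' h' k\<bar>
      \<le> 12 * N ^ 2 * E + 3 * N * (4 * N * (12 * N ^ 2 * E) + 2 * (3 * E))"
    unfolding interp_def N_def E_def
    by (rule prism_diff[OF B base_simplex[OF x] nbr(1,2) base_simplex[OF x'] nbr(1,2) _
          base_diff[OF x x' e] ramp_diff(2)[OF e(2)]]) simp
  also have "\<dots> = (12 * N ^ 2 + 144 * N ^ 4 + 18 * N ^ 1) * E"
    by (simp add: algebra_simps eval_nat_numeral)
  also have "\<dots> \<le> (12 * N ^ 4 + 144 * N ^ 4 + 18 * N ^ 4) * E"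
    using N E0 by (intro mult_right_mono add_mono mult_left_mono power_increasing) auto
  also have "\<dots> \<le> 200 * N ^ 4 * E"
    using N E0 by (intro mult_right_mono) auto
  finally show ?thesis by (simp add: N_def E_def)
qed

text \<open>Both sides are \<open>pushforward \<rho> (\<psi> (j + 1) x)\<close>: level
  \<open>j\<close> ends there with the prism completed, and level \<open>j + 1\<close> starts
  there.\<close>

lemma interp_agree:
  assumes "infdist x A \<le> S j"
  shows "interp j x (S j) = interp (j + 1) x (S j)"
proof -
  have "base j x (S j) = \<psi> (j + 1) x"
    by (simp add: base_def fun_eq_iff ramp_ends)
  then have "interp j x (S j) = pushforward \<rho> (\<psi> (j + 1) x)"
    using prism_1[OF B next_simplex[OF assms] nbr(1)] by (simp add: interp_def ramp_ends)
  moreover have "slide (j + 1) (S j) = 0" "push (j + 1) (S j) = 0"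
    using ramp_ends(1,2)[of "j + 1"] by simp_all
  then have "base (j + 1) x (S j) = pushforward \<rho> (\<psi> (j + 1) x)"
    by (simp add: base_def fun_eq_iff)
  then have "interp (j + 1) x (S j) = pushforward \<rho> (\<psi> (j + 1) x)"
    using prism_0[OF B base_simplex[of x "j + 1" "S j"] nbr(1)] assms S_mono[of j "j + 1"]
    by (simp add: interp_def \<open>push (j + 1) (S j) = 0\<close>)
  ultimately show ?thesis by simp
qed

section \<open>The map to the complex\<close>

definition to_nerve :: "'a \<Rightarrow> 'i \<Rightarrow> real" where
  "to_nerve x = interp (level (infdist x A)) x (infdist x A)"

text \<open>The vertices belong to scales \<open>j + 1\<close> and \<open>j + 2\<close>, and the
  height is at least \<open>S (j - 1)\<close>. Three scale steps give
  \<open>27 * (c + 1) ^ 3\<close>, and the bound on neighbours gives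
  \<open>5 * (c + 1)\<close>.\<close>

lemma to_nerve_simplex:
  assumes h: "0 < infdist x A"
  obtains \<tau> where "finite \<tau>" "card \<tau> \<le> n + 2" "to_nerve x \<in> std_simplex \<tau>"
    "\<And>i. i \<in> \<tau> \<Longrightarrow> dist x (a i) \<le> 135 * (c + 1) ^ 4 * infdist x A"
proof -
  define j where "j = level (infdist x A)"
  have j: "S (j - 1) \<le> infdist x A" "infdist x A \<le> S j"
    using level[OF h] by (auto simp: j_def)
  obtain \<tau> where \<tau>: "\<tau> \<subseteq> nbr (j + 1) x \<union> \<rho> ` nbr (j + 1) x" "card \<tau> \<le> card (nbr (j + 1) x) + 1"
      "to_nerve x \<in> std_simplex \<tau>"
    unfolding to_nerve_def interp_def j_def[symmetric]
    using prism_simplex[OF B base_simplex[OF j(2)] nbr(1)] by metis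
  have sub: "\<tau> \<subseteq> nbr (j + 1) x \<union> nbr (j + 2) x"
    using \<tau>(1) nbr(3)[of "j + 1" x] by (auto simp: add.assoc)
  show ?thesis
  proof (rule that)
    show "finite \<tau>" using sub nbr(1) by (meson finite_UnI finite_subset)
    show "card \<tau> \<le> n + 2" using \<tau>(2) nbr(2)[of "j + 1" x] by simp
    show "to_nerve x \<in> std_simplex \<tau>" by (rule \<tau>(3))
    fix i assume "i \<in> \<tau>"
    have "5 * (c + 1) * S (j + 1) \<le> 5 * (c + 1) * S (j + 2)"
      using c S_mono[of "j + 1" "j + 2"] by (intro mult_left_mono) auto
    then have "dist x (a i) \<le> 5 * (c + 1) * S (j + 2)"
      using \<open>i \<in> \<tau>\<close> sub near[of i "j + 1" x] near[of i "j + 2" x] by fastforce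
    also have "S (j + 2) = 27 * (c + 1) ^ 3 * S (j - 1)"
      using S_Suc[of "j - 1"] S_Suc[of j] S_Suc[of "j + 1"]
      by (simp add: add.assoc) (simp add: algebra_simps eval_nat_numeral)
    also have "5 * (c + 1) * \<dots> = 135 * (c + 1) ^ 4 * S (j - 1)"
      by (simp add: eval_nat_numeral)
    also have "\<dots> \<le> 135 * (c + 1) ^ 4 * infdist x A"
      using j c by (intro mult_left_mono) auto
    finally show "dist x (a i) \<le> 135 * (c + 1) ^ 4 * infdist x A" .
  qed
qed

text \<open>
  There need not be any point of the space at the height where two neighbouring levels meet,
  so the comparison uses the pair consisting of the point \<open>x'\<close> and the height \<open>S (j - 1)\<close>.
\<close>

lemma to_nerve_diff:
  assumes h': "0 < infdist x' A" "infdist x' A \<le> infdist x A" and d: "dist x x' \<le> infdist x A / 2"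
  shows "\<bar>to_nerve x k - to_nerve x' k\<bar> \<le> 600 * real (n + 1) ^ 4 * (dist x x' / infdist x A)"
proof -
  define h where "h = infdist x A"
  define h' where "h' = infdist x' A"
  define e where "e = dist x x'"
  define M where "M = 200 * real (n + 1) ^ 4"
  have M0: "0 \<le> M" by (simp add: M_def)
  have e0: "0 \<le> e" by (simp add: e_def)
  have pos: "0 < h'" "h' \<le> h" "0 < h" using assms by (auto simp: h_def h'_def)
  have he: "\<bar>h - h'\<bar> \<le> e" using infdist_triangle_abs[of x A x'] by (simp add: h_def h'_def e_def)
  have h2: "h / 2 \<le> h'" using he d by (simp add: h_def e_def)
  define j where "j = level h"
  have j: "S (j - 1) \<le> h" "h < S j" using level[OF pos(3)] by (auto simp: j_def)
  have l': "S (level h' - 1) \<le> h'" "h' < S (level h')" using level[OF pos(1)] by auto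
  have up: "level h' \<le> j"
  proof (rule ccontr)
    assume "\<not> level h' \<le> j"
    then have "S j \<le> S (level h' - 1)" by (intro S_mono) auto
    then show False using j l' pos by linarith
  qed
  have low: "j - 1 \<le> level h'"
  proof (rule ccontr)
    assume "\<not> j - 1 \<le> level h'"
    then have "S (level h') \<le> S (j - 2)" by (intro S_mono) auto
    moreover have "3 * S (j - 2) \<le> S (j - 1)" using S_step[of "j - 1"] by simp
    ultimately show False using j l' h2 pos S_pos[of "j - 2"] by linarith
  qed
  have x: "infdist x A \<le> S j" and x': "infdist x' A \<le> S j"
    using j pos by (auto simp: h_def h'_def)
  have "e / S j \<le> e / h" using j pos e0 by (intro divide_left_mono) auto
  then have M1: "M * (e / S j) \<le> M * (e / h)" using M0 by (rule mult_left_mono)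
  have "\<bar>to_nerve x k - to_nerve x' k\<bar> \<le> 3 * M * (e / h)"
  proof (cases "level h' = j")
    case True
    have "\<bar>to_nerve x k - to_nerve x' k\<bar> \<le> M * (e / S j)"
      using interp_diff[OF x x' _ he, of k] True
      by (simp add: to_nerve_def h_def h'_def j_def M_def e_def)
    moreover have "0 \<le> M * (e / h)" using M0 e0 pos by simp
    ultimately show ?thesis using M1 by linarith
  next
    case False
    with up low have lev: "level h' = j - 1" by simp
    have x'': "infdist x' A \<le> S (j - 1)" using l' lev by (simp add: h'_def)
    have mid: "h' \<le> S (j - 1)" using x'' by (simp add: h'_def)
    have "\<bar>h - S (j - 1)\<bar> \<le> e" "\<bar>S (j - 1) - h'\<bar> \<le> e"
      using he j mid by linarith+
    then have "\<bar>interp j x h k - interp j x' (S (j - 1)) k\<bar> \<le> M * (e / S j)"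
        "\<bar>interp (j - 1) x' (S (j - 1)) k - interp (j - 1) x' h' k\<bar> \<le> M * (e / S (j - 1))"
      using interp_diff[OF x x', of e] interp_diff[OF x'' x'', of e] e0 by (auto simp: M_def e_def)
    moreover have "interp (j - 1) x' (S (j - 1)) = interp j x' (S (j - 1))"
      using interp_agree[OF x''] by simp
    \<comment> \<open>The scale below is at least \<open>h / 2\<close>, so this part costs
      \<open>2 * M\<close>; with \<open>M\<close> from the part above, the total is
      \<open>3 * M\<close>.\<close>
    moreover have "M * (e / S (j - 1)) \<le> 2 * (M * (e / h))"
    proof -
      have "e / S (j - 1) \<le> e / (h / 2)"
        using mid h2 pos e0 S_pos by (intro divide_left_mono) (auto intro: mult_pos_pos)
      then have "M * (e / S (j - 1)) \<le> M * (e / (h / 2))" using M0 by (rule mult_left_mono)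
      then show ?thesis by (simp add: mult_ac)
    qed
    moreover have "to_nerve x = interp j x h" "to_nerve x' = interp (j - 1) x' h'"
      using lev by (simp_all add: to_nerve_def h_def h'_def j_def)
    ultimately show ?thesis using M1 by (auto simp: abs_le_iff)
  qed
  then show ?thesis by (simp add: M_def e_def h_def)
qed

end

section \<open>The extension\<close>

text \<open>The 0-sphere consists of two points at distance 2. Sending them to \<open>u\<close> and
  \<open>v\<close> is Lipschitz with constant \<open>dist u v / 2\<close>, and an extension to the
  interval still has these end values.\<close>

lemma lipschitz_connected_constant_ge_1:
  fixes Y :: "'b::metric_space set"
  assumes LC: "lipschitz_connected n lam Y" and uv: "u \<in> Y" "v \<in> Y" "u \<noteq> v"
  shows "1 \<le> lam"
proof -
  define e where "e = (\<lambda>t (i :: nat). if i = 0 then t else (0 :: real))"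
  define g where "g = (\<lambda>x :: nat \<Rightarrow> real. if x 0 = 1 then u else v)"
  have ed: "eucl_dist 1 x y = \<bar>x 0 - y 0\<bar>" for x y
    by (simp add: eucl_dist_def L2_set_def)
  have sph: "x 0 = 1 \<or> x 0 = - 1" if "x \<in> eucl_sphere 1" for x
    using that by (auto simp: eucl_sphere_def L2_set_def abs_if split: if_splits)
  have es: "e t \<in> eucl_sphere 1" "e t \<in> eucl_ball 1" if "\<bar>t\<bar> = 1" for t
    using that by (auto simp: e_def eucl_sphere_def eucl_ball_def L2_set_def)
  have maps: "g \<in> eucl_sphere (0 + 1) \<rightarrow> Y" using uv by (auto simp: g_def)
  have lip: "eucl_lipschitz_on (0 + 1) (dist u v / 2) (eucl_sphere (0 + 1)) g"
    unfolding eucl_lipschitz_on_def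
  proof (intro conjI ballI)
    fix x y assume "x \<in> eucl_sphere (0 + 1)" "y \<in> eucl_sphere (0 + 1)"
    then have "x 0 = 1 \<or> x 0 = - 1" "y 0 = 1 \<or> y 0 = - 1" using sph by auto
    then show "dist (g x) (g y) \<le> dist u v / 2 * eucl_dist (0 + 1) x y"
      using ed[of x y] by (auto simp: g_def dist_commute)
  qed simp
  obtain F where F: "eucl_lipschitz_on 1 (lam * (dist u v / 2)) (eucl_ball 1) F"
      "\<And>x. x \<in> eucl_sphere 1 \<Longrightarrow> F x = g x"
    using LC[unfolded lipschitz_connected_def, rule_format, OF le0 conjI[OF maps lip]] by auto
  have "dist (F (e 1)) (F (e (- 1))) \<le> lam * (dist u v / 2) * eucl_dist 1 (e 1) (e (- 1))"
    using F(1) es[of 1] es[of "- 1"] unfolding eucl_lipschitz_on_def by simp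
  moreover have "F (e 1) = u" "F (e (- 1)) = v"
    using F(2) es[of 1] es[of "- 1"] by (auto simp: g_def e_def)
  moreover have "eucl_dist 1 (e 1) (e (- 1)) = 2" unfolding ed by (simp add: e_def)
  ultimately have "1 * dist u v \<le> lam * dist u v" by simp
  then show ?thesis using uv(3) by (simp only: mult_le_cancel_right) (simp add: less_le)
qed

text \<open>Otherwise \<open>q\<close> vanishes on \<open>\<sigma>\<close>, all entries of
  \<open>p\<close> there are at most \<open>\<delta>\<close>, and they cannot add up to 1.\<close>

lemma common_vertex:
  assumes p: "p \<in> std_simplex \<sigma>" "finite \<sigma>" "card \<sigma> \<le> m" and q: "q \<in> std_simplex \<tau>"
    and d: "\<And>i. \<bar>p i - q i\<bar> \<le> \<delta>" "\<delta> * real m < 1"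
  obtains k where "k \<in> \<sigma>" "k \<in> \<tau>"
proof -
  have "\<exists>k. k \<in> \<sigma> \<and> k \<in> \<tau>"
  proof (rule ccontr)
    assume none: "\<nexists>k. k \<in> \<sigma> \<and> k \<in> \<tau>"
    have d0: "0 \<le> \<delta>" using sup_bound_nonneg[of p q] d(1) by blast
    have "p i \<le> \<delta>" if "i \<in> \<sigma>" for i
      using d(1)[of i] that none q by (auto simp: std_simplex_def)
    then have "sum p \<sigma> \<le> (\<Sum>i\<in>\<sigma>. \<delta>)" by (intro sum_mono)
    also have "\<dots> = \<delta> * real (card \<sigma>)" by simp
    also have "\<dots> \<le> \<delta> * real m" using p d0 by (intro mult_left_mono) auto
    finally show False using d(2) p by (simp add: std_simplex_def)
  qed
  then show ?thesis using that by blast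
qed

text \<open>Let \<open>h\<close> be the larger height and \<open>d\<close> the distance. If
  \<open>h \<le> 1200 * N ^ 5 * d\<close>, both values are compared with values of \<open>f\<close>
  at nearby points of \<open>A\<close>. Otherwise the images in the complex are so close that their
  simplices share a vertex, and gluing applies.\<close>

lemma lipschitz_extension_nagata:
  fixes n :: nat and c lam :: real
    and X A :: "'a::metric_space set" and Y :: "'b::metric_space set" and f :: "'a \<Rightarrow> 'b"
  defines "K \<equiv> (54 * lam * real (n + 2) ^ 7) ^ (n + 1)"
  assumes c: "c > 0" and cl: "closedin (top_of_set X) A" and nag: "nagata n c A" and A: "A \<noteq> {}"
    and LC: "lipschitz_connected n lam Y" and lam: "1 \<le> lam"
    and fY: "f \<in> A \<rightarrow> Y" and f: "1-lipschitz_on A f"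
  shows "\<exists>F. F \<in> X \<rightarrow> Y \<and> (\<forall>x\<in>A. F x = f x) \<and>
    (10 ^ 6 * real (n + 1) ^ 5 * K * (c + 1) ^ 4)-lipschitz_on X F"
proof -
  define S where "S = (\<lambda>j :: int. (3 * (c + 1)) powi j)"
  have S: "0 < S j" "S (j + 1) = 3 * (c + 1) * S j" for j
    using c by (simp_all add: S_def power_int_add)
  obtain nbr :: "int \<Rightarrow> 'a \<Rightarrow> (int \<times> 'a set) set" and \<psi> \<rho> a
    where sys: "\<And>j x. finite (nbr j x)" "\<And>j x. card (nbr j x) \<le> n + 1"
    "\<And>j x. infdist x A \<le> S j \<Longrightarrow> \<psi> j x \<in> std_simplex (nbr j x)"
    "\<And>j x x' i. \<lbrakk>infdist x A \<le> S j; infdist x' A \<le> S j\<rbrakk> \<Longrightarrow>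
       \<bar>\<psi> j x i - \<psi> j x' i\<bar> \<le> 3 * real (n + 1) / S j * dist x x'"
    "\<And>j x. \<rho> ` nbr j x \<subseteq> nbr (j + 1) x"
    "\<And>i. a i \<in> A" "\<And>j x i. i \<in> nbr j x \<Longrightarrow> dist x (a i) \<le> 5 * (c + 1) * S j"
    by (rule nagata_scales[OF nag c A, of S, OF S]) (rule that; assumption)
  obtain B :: "int \<times> 'a set \<Rightarrow> (int \<times> 'a set) set" where B: "predecessor_sets B"
    using predecessor_sets_exist by blast
  interpret scale_system n c A S nbr \<psi> \<rho> a B
    using c sys B by unfold_locales (auto simp: S_def)
  define y where "y = (\<lambda>i. f (a i))"
  have "y i \<in> Y" for i unfolding y_def using fY sys(6) by (rule funcset_mem)
  then have "\<exists>G. (\<forall>i. G (\<lambda>j. if j = i then 1 else 0) = y i) \<and>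
      (\<forall>\<sigma>. finite \<sigma> \<and> \<sigma> \<noteq> {} \<and> card \<sigma> \<le> n + 1 + 1 \<longrightarrow> G \<in> std_simplex \<sigma> \<rightarrow> Y \<and>
        sup_lipschitz_on (K * diameter (y ` \<sigma>)) (std_simplex \<sigma>) G)"
    unfolding K_def by (intro skeleton_extension[OF LC lam]) auto
  then obtain G where G: "\<forall>i. G (\<lambda>j. if j = i then 1 else 0) = y i"
    "\<forall>\<sigma>. finite \<sigma> \<and> \<sigma> \<noteq> {} \<and> card \<sigma> \<le> n + 1 + 1 \<longrightarrow> G \<in> std_simplex \<sigma> \<rightarrow> Y \<and>
        sup_lipschitz_on (K * diameter (y ` \<sigma>)) (std_simplex \<sigma>) G"
    by blast
  have vert: "G (\<lambda>j. if j = i then 1 else 0) = y i" for i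
    using G(1) by blast
  have GY: "G \<in> std_simplex \<sigma> \<rightarrow> Y"
    and GL: "sup_lipschitz_on (K * diameter (y ` \<sigma>)) (std_simplex \<sigma>) G"
    if "finite \<sigma>" "\<sigma> \<noteq> {}" "card \<sigma> \<le> n + 2" for \<sigma>
    using G(2) that by auto
  define F where "F = (\<lambda>x. if x \<in> A then f x else G (to_nerve x))"
  define C where "C = 135 * (c + 1) ^ 4"
  define N where "N = real (n + 1)"
  have N1: "1 \<le> N" by (simp add: N_def)
  have C0: "0 \<le> C" using c by (simp add: C_def)
  have "1 * 1 * 1 \<le> 54 * lam * real (n + 2) ^ 7"
    using lam by (intro mult_mono one_le_power) auto
  then have K1: "1 \<le> K" unfolding K_def by (intro one_le_power) simp
  have fd: "dist (f z) (f z') \<le> dist z z'" if "z \<in> A" "z' \<in> A" for z z'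
    using lipschitz_onD[OF f that] by simp
  have AX: "A \<subseteq> X" using closedin_subset[OF cl] by simp
  have pos: "0 < infdist x A" if x: "x \<in> X" "x \<notin> A" for x
  proof -
    obtain T where T: "closed T" "A = X \<inter> T" using cl by (auto simp: closedin_closed)
    \<comment> \<open>\<open>A\<close> is closed only relative to \<open>X\<close>, so the closure
      in the whole type is controlled through \<open>T\<close>.\<close>
    have "x \<notin> closure A" using T x closure_minimal[of A T] by blast
    then show ?thesis
      using in_closure_iff_infdist_zero[OF A, of x] infdist_nonneg[of x A] by linarith
  qed
  have simp: "\<exists>\<tau>. finite \<tau> \<and> \<tau> \<noteq> {} \<and> card \<tau> \<le> n + 2 \<and> to_nerve x \<in> std_simplex \<tau> \<and>
      (\<forall>i\<in>\<tau>. dist x (a i) \<le> C * infdist x A) \<and>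
      sup_lipschitz_on (K * (2 * C * infdist x A)) (std_simplex \<tau>) G"
    if x: "x \<in> X" "x \<notin> A" for x
  proof -
    obtain \<tau> where \<tau>: "finite \<tau>" "card \<tau> \<le> n + 2" "to_nerve x \<in> std_simplex \<tau>"
      "\<And>i. i \<in> \<tau> \<Longrightarrow> dist x (a i) \<le> C * infdist x A"
      using to_nerve_simplex[OF pos[OF x]] unfolding C_def by metis
    \<comment> \<open>The standard simplex on the empty set is empty, since an empty sum is not
      1.\<close>
    have ne: "\<tau> \<noteq> {}" using \<tau>(3) by (auto simp: std_simplex_def)
    have "diameter (y ` \<tau>) \<le> 2 * C * infdist x A"
    proof (rule diameter_le_dist)
      show "0 \<le> 2 * C * infdist x A" using C0 infdist_nonneg[of x A] by simp
      fix u v assume "u \<in> y ` \<tau>" "v \<in> y ` \<tau>"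
      then obtain i k where ik: "i \<in> \<tau>" "k \<in> \<tau>" "u = f (a i)" "v = f (a k)" by (auto simp: y_def)
      have "dist u v \<le> dist (a i) (a k)" using fd sys(6) ik by simp
      also have "\<dots> \<le> dist x (a i) + dist x (a k)" by (rule dist_triangle3)
      finally show "dist u v \<le> 2 * C * infdist x A" using \<tau>(4)[OF ik(1)] \<tau>(4)[OF ik(2)] by linarith
    qed
    then have "K * diameter (y ` \<tau>) \<le> K * (2 * C * infdist x A)"
      using K1 by (intro mult_left_mono) auto
    then have "sup_lipschitz_on (K * (2 * C * infdist x A)) (std_simplex \<tau>) G"
      using sup_lipschitz_on_le[OF GL[OF \<tau>(1) ne \<tau>(2)]] by blast
    with \<tau> ne show ?thesis by blast
  qed
  have FY: "F x \<in> Y" if "x \<in> X" for x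
  proof (cases "x \<in> A")
    case True
    then show ?thesis using fY by (auto simp: F_def)
  next
    case False
    from simp[OF that False] obtain \<tau> where "finite \<tau>" "\<tau> \<noteq> {}" "card \<tau> \<le> n + 2" "to_nerve x \<in> std_simplex \<tau>"
      by blast
    then show ?thesis using GY False by (auto simp: F_def)
  qed
  have anchor: "\<exists>z\<in>A. dist x z \<le> C * infdist x A \<and> dist (F x) (f z) \<le> K * (2 * C * infdist x A)"
    if x: "x \<in> X" for x
  proof (cases "x \<in> A")
    case True
    then show ?thesis by (intro bexI[of _ x]) (auto simp: F_def)
  next
    case False
    from simp[OF x False] obtain \<tau> i where \<tau>: "finite \<tau>" "to_nerve x \<in> std_simplex \<tau>" "i \<in> \<tau>"
      "dist x (a i) \<le> C * infdist x A"
      "sup_lipschitz_on (K * (2 * C * infdist x A)) (std_simplex \<tau>) G" by blast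
    have v: "(\<lambda>j. if j = i then 1 else 0) \<in> std_simplex \<tau>"
      using \<tau> by (simp add: std_simplex_def)
    have "dist (G (to_nerve x)) (G (\<lambda>j. if j = i then 1 else 0)) \<le> K * (2 * C * infdist x A) * 1"
    proof (rule sup_lipschitz_onD[OF \<tau>(5,2) v])
      fix k
      have "0 \<le> to_nerve x k" by (rule std_simplex_nonneg[OF \<tau>(2)])
      moreover have "to_nerve x k \<le> 1" by (rule std_simplex_le_one[OF \<tau>(1,2)])
      ultimately show "\<bar>to_nerve x k - (if k = i then 1 else 0)\<bar> \<le> 1" by auto
    qed
    then show ?thesis
      using False \<tau>(4) sys(6)[of i] vert[of i] by (intro bexI[of _ "a i"]) (auto simp: F_def y_def)
  qed
  define W where "W = 10 ^ 6 * N ^ 5 * K * (c + 1) ^ 4"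
  \<comment> \<open>Since \<open>7200 * 135 = 972000\<close> and \<open>Z \<ge> 1\<close>, the
    factor \<open>10 ^ 6\<close> leaves room for the extra summand 1.\<close>
  define Z where "Z = N ^ 5 * K * (c + 1) ^ 4"
  have "1 * 1 * 1 \<le> Z"
    unfolding Z_def using N1 K1 c by (intro mult_mono one_le_power) auto
  moreover have "7200 * N ^ 5 * (C * K) = 972000 * Z" by (simp add: C_def Z_def)
  moreover have "W = 1000000 * Z" by (simp add: W_def Z_def)
  ultimately have CW: "7200 * N ^ 5 * (C * K) + 1 \<le> W" by linarith
  have main: "dist (F x) (F x') \<le> W * dist x x'"
    if x: "x \<in> X" and x': "x' \<in> X" and le: "infdist x' A \<le> infdist x A" for x x'
  proof -
    define h where "h = infdist x A"
    define d where "d = dist x x'"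
    have h0: "0 \<le> h" by (simp add: h_def infdist_nonneg)
    have d0: "0 \<le> d" by (simp add: d_def)
    have "dist (F x) (F x') \<le> 7200 * N ^ 5 * (C * K) * d + d"
    \<comment> \<open>The threshold is where \<open>\<delta> * (2 * N)\<close> reaches 1 for
      \<open>\<delta> = 600 * N ^ 4 * (d / h)\<close>. Both cases then cost 7200:
      \<open>6 * 1200\<close> here, \<open>2 * 3 * 2 * 600\<close> in the other.\<close>
    proof (cases "h \<le> 1200 * N ^ 5 * d")
      case True
      obtain z where z: "z \<in> A" "dist x z \<le> C * h" "dist (F x) (f z) \<le> K * (2 * C * h)"
        using anchor[OF x] by (auto simp: h_def)
      obtain z' where z': "z' \<in> A" "dist x' z' \<le> C * infdist x' A"
        "dist (F x') (f z') \<le> K * (2 * C * infdist x' A)"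
        using anchor[OF x'] by auto
      have C'h: "C * infdist x' A \<le> C * h" using le C0 by (auto simp: h_def intro: mult_left_mono)
      have "K * (2 * C * infdist x' A) \<le> K * (2 * C * h)"
        using K1 C0 le by (intro mult_left_mono) (auto simp: h_def)
      then have z'h: "dist x' z' \<le> C * h" "dist (F x') (f z') \<le> K * (2 * C * h)"
        using z' C'h by linarith+
      have "dist (f z) (f z') \<le> dist z z'" using fd z z' by simp
      also have "\<dots> \<le> dist x z + d + dist x' z'"
        using dist_triangle[of z z' x] dist_triangle[of x z' x'] by (simp add: d_def dist_commute)
      finally have fz: "dist (f z) (f z') \<le> 2 * (C * h) + d" using z z'h by linarith
      have "dist (F x) (F x') \<le> dist (F x) (f z) + dist (f z) (f z') + dist (F x') (f z')"
        using dist_triangle[of "F x" "F x'" "f z"] dist_triangle[of "f z" "F x'" "f z'"]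
        by (simp add: dist_commute)
      also have "\<dots> \<le> 4 * (K * (C * h)) + 2 * (C * h) + d" using z z'h fz by simp
      also have "\<dots> \<le> 6 * (K * (C * h)) + d"
        using mult_right_mono[OF K1, of "C * h"] C0 h0 by (simp add: mult_ac)
      also have "\<dots> \<le> 6 * (K * (C * (1200 * N ^ 5 * d))) + d"
        using True K1 C0 by (intro add_right_mono mult_left_mono) auto
      finally show ?thesis by (simp add: mult_ac)
    next
      case False
      have "1 \<le> N ^ 5" using N1 by (rule one_le_power)
      then have "2 * d \<le> 1200 * N ^ 5 * d" using d0 by (intro mult_right_mono) linarith+
      then have dh: "d < h" "d \<le> h / 2" "0 < h" using False d0 by linarith+
      have xA: "x \<notin> A" using dh by (auto simp: h_def)
      have x'A: "x' \<notin> A" using infdist_le[of x' A x] dh by (auto simp: h_def d_def)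
      define \<delta> where "\<delta> = 600 * N ^ 4 * (d / h)"
      have \<delta>: "\<bar>to_nerve x k - to_nerve x' k\<bar> \<le> \<delta>" for k
        using to_nerve_diff[OF pos[OF x' x'A] le, of k] dh by (simp add: \<delta>_def N_def d_def h_def)
      have \<delta>0: "0 \<le> \<delta>" using d0 h0 N1 by (simp add: \<delta>_def)
      have n2: "real (n + 2) \<le> 2 * N" by (simp add: N_def)
      have "\<delta> * real (n + 2) \<le> \<delta> * (2 * N)" using n2 \<delta>0 by (rule mult_left_mono)
      also have "\<dots> = 1200 * N ^ 5 * d / h" by (simp add: \<delta>_def eval_nat_numeral)
      also have "\<dots> < 1" using False dh by simp
      finally have \<delta>1: "\<delta> * real (n + 2) < 1" .
      from simp[OF x xA] obtain \<tau> where \<tau>: "finite \<tau>" "card \<tau> \<le> n + 2" "to_nerve x \<in> std_simplex \<tau>"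
        "sup_lipschitz_on (K * (2 * C * h)) (std_simplex \<tau>) G" unfolding h_def by blast
      from simp[OF x' x'A] obtain \<tau>' where \<tau>': "finite \<tau>'" "to_nerve x' \<in> std_simplex \<tau>'"
        "sup_lipschitz_on (K * (2 * C * infdist x' A)) (std_simplex \<tau>') G" by blast
      have "K * (2 * C * infdist x' A) \<le> K * (2 * C * h)"
        using le K1 C0 by (auto simp: h_def intro!: mult_left_mono)
      then have \<tau>'h: "sup_lipschitz_on (K * (2 * C * h)) (std_simplex \<tau>') G"
        using sup_lipschitz_on_le[OF \<tau>'(3)] by blast
      obtain k where k: "k \<in> \<tau>" "k \<in> \<tau>'"
        by (rule common_vertex[OF \<tau>(3,1,2) \<tau>'(2) \<delta> \<delta>1])
      have "dist (G (to_nerve x)) (G (to_nerve x')) \<le> K * (2 * C * h) * (3 * real (n + 2) * \<delta>)"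
        using K1 C0 h0 by (intro sup_lipschitz_glue[OF \<tau>(1,2) k \<tau>'(1) _ \<tau>(4) \<tau>'h \<tau>(3) \<tau>'(2) \<delta>]) auto
      also have "\<dots> \<le> K * (2 * C * h) * (3 * (2 * N) * \<delta>)"
        using K1 C0 h0 n2 \<delta>0 by (intro mult_left_mono mult_right_mono) auto
      also have "\<dots> = 7200 * N ^ 5 * (C * K) * d"
        using dh by (simp add: \<delta>_def eval_nat_numeral)
      finally show ?thesis using xA x'A d0 by (simp add: F_def)
    qed
    also have "\<dots> = (7200 * N ^ 5 * (C * K) + 1) * d" by (simp add: algebra_simps)
    also have "\<dots> \<le> W * d" using CW d0 by (rule mult_right_mono)
    finally show ?thesis by (simp add: d_def)
  qed
  have "W-lipschitz_on X F"
  proof (rule lipschitz_onI)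
    show "dist (F x) (F x') \<le> W * dist x x'" if "x \<in> X" "x' \<in> X" for x x'
      using main[OF that] main[OF that(2,1)] by (cases "infdist x' A \<le> infdist x A") (auto simp: dist_commute)
    show "0 \<le> W" using N1 K1 c by (simp add: W_def)
  qed
  moreover have "\<forall>x\<in>A. F x = f x" by (simp add: F_def)
  ultimately show ?thesis using FY unfolding W_def N_def by blast
qed

section \<open>Absorbing the numerical constants\<close>

lemma geometric_bound:
  fixes n E :: nat
  assumes "8014 \<le> E"
  shows "10 ^ 6 * (10 ^ 8) ^ (n + 1) \<le> (10 :: real) ^ E * real (n + 1) ^ (3 * n)"
\<comment> \<open>For small \<open>n\<close> the left side is \<open>10 ^ (14 + 8 * n)\<close>,
  whence \<open>8014 = 14 + 8 * 1000\<close>. For larger \<open>n\<close> the base satisfies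
  \<open>(n + 1) ^ 3 \<ge> 10 ^ 8\<close>.\<close>
proof (cases "n < 1000")
  case True
  have "10 ^ 6 * (10 ^ 8) ^ (n + 1) = (10 :: real) ^ (14 + 8 * n)"
    by (simp add: power_add power_mult)
  also have "\<dots> \<le> 10 ^ E" using True assms by (intro power_increasing) auto
  also have "\<dots> = 10 ^ E * 1" by simp
  also have "\<dots> \<le> 10 ^ E * real (n + 1) ^ (3 * n)"
    by (intro mult_left_mono one_le_power) auto
  finally show ?thesis .
next
  case False
  have "10 ^ 6 * (10 ^ 8) ^ (n + 1) = (10 :: real) ^ 14 * (10 ^ 8) ^ n"
    by simp
  also have "\<dots> \<le> 10 ^ E * (real (n + 1) ^ 3) ^ n"
  proof (intro mult_mono power_mono)
    show "(10 :: real) ^ 14 \<le> 10 ^ E" using assms by (intro power_increasing) auto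
    have "(10 :: real) ^ 8 \<le> 1000 ^ 3" by simp
    also have "\<dots> \<le> real (n + 1) ^ 3" using False by (intro power_mono) auto
    finally show "10 ^ 8 \<le> real (n + 1) ^ 3" .
  qed auto
  also have "\<dots> = 10 ^ E * real (n + 1) ^ (3 * n)" by (simp add: power_mult)
  finally show ?thesis .
qed

text \<open>The available power of \<open>n + 1\<close> has exponent \<open>10 * n\<close>, which is
  0 for \<open>n = 0\<close>. So the surplus \<open>N ^ 12\<close> beyond \<open>N ^ (7 * n)\<close>
  is first turned into the geometric factor \<open>4096 ^ m\<close>; together with
  \<open>6912 ^ m\<close>, where \<open>6912 = 54 * 2 ^ 7\<close>, it stays below
  \<open>(10 ^ 8) ^ m\<close>, and \<open>N ^ (3 * n)\<close> remains to pay for this.\<close>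

lemma extension_constant_bound:
  fixes n E :: nat and c lam :: real
  assumes E: "8014 \<le> E" and c: "0 \<le> c" and lam: "0 \<le> lam"
  shows "10 ^ 6 * real (n + 1) ^ 5 * (54 * lam * real (n + 2) ^ 7) ^ (n + 1) * (c + 1) ^ 4
    \<le> 10 ^ E * lam ^ (n + 1) * (c + 1) ^ 10 * real (n + 1) ^ (10 * n)"
proof -
  define m where "m = n + 1"
  define N where "N = real m"
  have N1: "1 \<le> N" by (simp add: N_def m_def)
  have "real (n + 2) \<le> 2 * N" by (simp add: N_def m_def)
  then have "(54 * lam * real (n + 2) ^ 7) ^ m \<le> (54 * lam * (2 * N) ^ 7) ^ m"
    using lam by (intro power_mono mult_left_mono) auto
  also have "54 * lam * (2 * N) ^ 7 = 6912 * lam * N ^ 7"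
    by (simp add: power_mult_distrib)
  also have "\<dots> ^ m = 6912 ^ m * lam ^ m * N ^ (7 * m)"
    by (simp add: power_mult_distrib power_mult)
  finally have K: "(54 * lam * real (n + 2) ^ 7) ^ m \<le> 6912 ^ m * lam ^ m * N ^ (7 * m)" .
  have "N \<le> 2 ^ m" unfolding N_def using of_nat_less_two_power[of m] by (rule less_imp_le)
  then have "N ^ 12 \<le> (2 ^ m) ^ 12" using N1 by (intro power_mono) auto
  also have "(2 ^ m) ^ 12 = ((2 :: real) ^ 12) ^ m" 
    unfolding power_mult[symmetric] by (simp only: mult.commute)
  finally have N12: "N ^ 12 \<le> 4096 ^ m" by simp
  have "10 ^ 6 * N ^ 5 * (54 * lam * real (n + 2) ^ 7) ^ m * (c + 1) ^ 4
      \<le> 10 ^ 6 * N ^ 5 * (6912 ^ m * lam ^ m * N ^ (7 * m)) * (c + 1) ^ 4"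
    using K N1 c by (intro mult_right_mono mult_left_mono) auto
  also have "\<dots> = 10 ^ 6 * 6912 ^ m * N ^ 12 * (lam ^ m * N ^ (7 * n) * (c + 1) ^ 4)"
  proof -
    have "N ^ 5 * N ^ (7 * m) = N ^ 12 * N ^ (7 * n)"
      by (simp add: m_def power_add[symmetric])
    then show ?thesis by (simp add: mult_ac)
  qed
  also have "\<dots> \<le> 10 ^ 6 * 6912 ^ m * 4096 ^ m * (lam ^ m * N ^ (7 * n) * (c + 1) ^ 4)"
    using N12 N1 c lam by (intro mult_right_mono mult_left_mono) auto
  also have "\<dots> = 10 ^ 6 * 28311552 ^ m * (lam ^ m * N ^ (7 * n) * (c + 1) ^ 4)"
    by (simp add: power_mult_distrib[symmetric])
  also have "\<dots> \<le> 10 ^ 6 * (10 ^ 8) ^ m * (lam ^ m * N ^ (7 * n) * (c + 1) ^ 4)"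
    using N1 c lam by (intro mult_right_mono mult_left_mono power_mono) auto
  also have "\<dots> \<le> 10 ^ E * N ^ (3 * n) * (lam ^ m * N ^ (7 * n) * (c + 1) ^ 10)"
  proof (rule mult_mono)
    show "10 ^ 6 * (10 ^ 8) ^ m \<le> 10 ^ E * N ^ (3 * n)"
      using geometric_bound[OF E, of n] by (simp only: m_def N_def)
    show "lam ^ m * N ^ (7 * n) * (c + 1) ^ 4 \<le> lam ^ m * N ^ (7 * n) * (c + 1) ^ 10"
      using N1 c lam by (intro mult_left_mono power_increasing) auto
  qed (use N1 c lam in auto)
  also have "\<dots> = 10 ^ E * lam ^ m * (c + 1) ^ 10 * N ^ (10 * n)"
  proof -
    have "N ^ (10 * n) = N ^ (3 * n) * N ^ (7 * n)" by (simp add: power_add[symmetric])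
    then show ?thesis by (simp add: mult_ac)
  qed
  finally show ?thesis by (simp only: N_def m_def)
qed

text \<open>If \<open>A\<close> is empty or \<open>Y\<close> is a single point, a constant map
  works; otherwise \<open>lam \<ge> 1\<close>. The exponent is a variable so that the enormous power
  of 10 is never evaluated.\<close>

lemma lipschitz_extension_exponent:
  fixes n E :: nat and c lam :: real
    and X A :: "'a::metric_space set" and Y :: "'b::metric_space set" and f :: "'a \<Rightarrow> 'b"
  assumes E: "8014 \<le> E" and c: "c > 0" and cl: "closedin (top_of_set X) A" and nag: "nagata n c A"
    and Y: "Y \<noteq> {}" and LC: "lipschitz_connected n lam Y"
    and fY: "f \<in> A \<rightarrow> Y" and f: "1-lipschitz_on A f"
  shows "\<exists>F. F \<in> X \<rightarrow> Y \<and> (\<forall>x\<in>A. F x = f x) \<and>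
    (10 ^ E * lam ^ (n + 1) * (c + 1) ^ 10 * real (n + 1) ^ (10 * n))-lipschitz_on X F"
proof -
  obtain y where y: "y \<in> Y" using Y by blast
  \<comment> \<open>A constant map is 1-Lipschitz, and the constant \<open>lam * 1\<close> of its
    extension is non-negative by definition.\<close>
  have lam0: "0 \<le> lam"
  proof -
    have "(\<lambda>x. y) \<in> eucl_sphere (0 + 1) \<rightarrow> Y \<and>
        eucl_lipschitz_on (0 + 1) 1 (eucl_sphere (0 + 1)) (\<lambda>x. y)"
      using y by (simp add: eucl_lipschitz_on_def eucl_dist_def L2_set_nonneg)
    from LC[unfolded lipschitz_connected_def, rule_format, OF le0 this]
    show ?thesis by (auto simp: eucl_lipschitz_on_def)
  qed
  define W where "W = 10 ^ E * lam ^ (n + 1) * (c + 1) ^ 10 * real (n + 1) ^ (10 * n)"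
  have W0: "0 \<le> W" using lam0 c by (simp add: W_def)
  have "\<exists>F. F \<in> X \<rightarrow> Y \<and> (\<forall>x\<in>A. F x = f x) \<and> W-lipschitz_on X F"
  proof (cases "A = {} \<or> (\<forall>u\<in>Y. u = y)")
    case True
    have "y = f x" if "x \<in> A" for x
      using True that funcset_mem[OF fY that] by auto
    moreover have "W-lipschitz_on X (\<lambda>x. y)" using W0 by (simp add: lipschitz_on_def)
    ultimately show ?thesis using y by (intro exI[of _ "\<lambda>x. y"]) auto
  next
    case False
    then obtain u where "u \<in> Y" "u \<noteq> y" and A: "A \<noteq> {}" by blast
    then have "1 \<le> lam" using lipschitz_connected_constant_ge_1[OF LC _ y] by blast
    from lipschitz_extension_nagata[OF c cl nag A LC this fY f]
    obtain F where "F \<in> X \<rightarrow> Y" "\<forall>x\<in>A. F x = f x"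
      "(10 ^ 6 * real (n + 1) ^ 5 * (54 * lam * real (n + 2) ^ 7) ^ (n + 1) * (c + 1) ^ 4)-lipschitz_on X F"
      by blast
    moreover have "10 ^ 6 * real (n + 1) ^ 5 * (54 * lam * real (n + 2) ^ 7) ^ (n + 1) * (c + 1) ^ 4 \<le> W"
      unfolding W_def using c lam0 by (intro extension_constant_bound[OF E]) auto
    ultimately show ?thesis using lipschitz_on_le by blast
  qed
  then show ?thesis by (simp only: W_def)
qed

theorem theorem1p1:
  fixes n :: nat and c lam :: real
    and X A :: "'a::metric_space set"
    and Y :: "'b::metric_space set"
    and f :: "'a \<Rightarrow> 'b"
  assumes "c > 0"
    and "closedin (top_of_set X) A"
    and "nagata n c A"
    and "Y \<noteq> {}"
    and "lipschitz_connected n lam Y"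
    and "f \<in> A \<rightarrow> Y"
    and "1-lipschitz_on A f"
  shows "\<exists>F. F \<in> X \<rightarrow> Y \<and> (\<forall>x\<in>A. F x = f x) \<and>
    (10 ^ (10 ^ 10) * lam ^ (n + 1) * (c + 1) ^ 10 * real (n + 1) ^ (10 * n))-lipschitz_on X F"
proof (rule lipschitz_extension_exponent)
  show "8014 \<le> (10 :: nat) ^ 10" by simp
qed (fact assms)+

end
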